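(* Let $\mathcal{O}$ be a one-counter system with $n$ states. Suppose a configuration $\beta=(p_\beta,c_\beta)$ is reachable from a configuration $\alpha=(p_\alpha,c_\alpha)$ in $\mathcal{O}$. Then $\mathcal{O}$ has a path from $\alpha$ to $\beta$ of length at most $14n^2+n\cdot\max(c_\alpha,c_\beta)$.
   Context: $\mathbb{N}=\{0,1,2,\dots\}$. A one-counter system (OCS) $\mathcal{O}$ consists of a finite set $Q$ of states, a set $T_{>0}\subseteq Q\times\{-1,0,1\}\times Q$ of non-zero transitions and a set $T_{=0}\subseteq Q\times\{0,1\}\times Q$ of zero tests; $T=T_{>0}\cup T_{=0}$. A configuration is a pair $(q,c)\in Q\times\mathbb{N}$, with state $q$ and counter value $c$. A transition $t=(p,d,q)\in T$ can be fired in configuration $(p,c)$ if either $t\in T_{>0}$ and $c>0$, or $t\in T_{=0}$ and $c=0$; the result is $(q,c+d)$, and we write $(p,c)\xrightarrow{t}(q,c+d)$. A path is a sequence $(\gamma_1,t_1)(\gamma_2,t_2)\cdots(\gamma_m,t_m)$ of configurations and transitions such that there are configurations with $\gamma_i\xrightarrow{t_i}\gamma_{i+1}$ for $i=1,\dots,m$; its source is $\gamma_1$, its target is $\gamma_{m+1}$, its length is $m$, and it is a path from its source to its target. A configuration $\beta$ is reachable from $\alpha$ if there is a path from $\alpha$ to $\beta$ (the length-$0$ path witnesses $\alpha$ reachable from itself). *)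

theory Defs
  imports Main
begin

record 'q ocs =
  states :: "'q set"
  tpos   :: "('q \<times> int \<times> 'q) set"
  tzero  :: "('q \<times> int \<times> 'q) set"

definition wf_ocs :: "'q ocs \<Rightarrow> bool" where
  "wf_ocs S \<longleftrightarrow> finite (states S)
     \<and> tpos S \<subseteq> states S \<times> {-1,0,1} \<times> states S
     \<and> tzero S \<subseteq> states S \<times> {0,1} \<times> states S"

type_synonym 'q config = "'q \<times> nat"

definition trans :: "'q ocs \<Rightarrow> ('q \<times> int \<times> 'q) set" where
  "trans S = tpos S \<union> tzero S"

definition step :: "'q ocs \<Rightarrow> 'q config \<Rightarrow> ('q \<times> int \<times> 'q) \<Rightarrow> 'q config \<Rightarrow> bool" where
  "step S \<gamma> t \<gamma>' \<longleftrightarrow>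
     (case t of (p, d, q) \<Rightarrow>
        fst \<gamma> = p
        \<and> ((t \<in> tpos S \<and> snd \<gamma> > 0) \<or> (t \<in> tzero S \<and> snd \<gamma> = 0))
        \<and> int (snd \<gamma>') = int (snd \<gamma>) + d \<and> fst \<gamma>' = q)"

fun is_path :: "'q ocs \<Rightarrow> ('q config \<times> ('q \<times> int \<times> 'q)) list \<Rightarrow> 'q config \<Rightarrow> 'q config \<Rightarrow> bool" where
  "is_path S [] \<alpha> \<beta> \<longleftrightarrow> \<alpha> = \<beta>"
| "is_path S ((\<gamma>, t) # \<pi>) \<alpha> \<beta> \<longleftrightarrow>
     \<gamma> = \<alpha> \<and> (\<exists>\<gamma>'. step S \<gamma> t \<gamma>' \<and> is_path S \<pi> \<gamma>' \<beta>)"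

definition reachable :: "'q ocs \<Rightarrow> 'q config \<Rightarrow> 'q config \<Rightarrow> bool" where
  "reachable S \<alpha> \<beta> \<longleftrightarrow> (\<exists>\<pi>. is_path S \<pi> \<alpha> \<beta>)"

end

theory Submission
  imports Defs Complex_Main "HOL-Number_Theory.Cong" "HOL-Library.Disjoint_Sets"
begin

text \<open>
  Ignoring positivity, the non-zero transitions form a weighted graph. Fix a maximal family \<open>F\<close> of
  pairwise disjoint simple cycles of positive effect in it, and likewise a family \<open>G\<close> of negative
  cycles. A path that climbs by \<open>n\<close> meets a cycle of \<open>F\<close>, and one that descends by \<open>n\<close> meets one of
  \<open>G\<close>. Hence everything a path does above \<open>H + n\<close>, where \<open>H = max c\<^sub>\<alpha> c\<^sub>\<beta> + n\<close>, can be replaced by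
  jumps between configurations in the band from \<open>H\<close> to \<open>H + n\<close>, leading from a cycle \<open>X\<close> in \<open>F\<close> of
  effect \<open>A X\<close> to a cycle \<open>Y\<close> in \<open>G\<close> of effect \<open>- B Y\<close>. Pumping \<open>X\<close> and \<open>Y\<close> shows that a jump is
  possible as soon as some walk has the right effect modulo \<open>gcd (A X) (B Y)\<close>.

  Take a shortest sequence of low steps and jumps. Its configurations are distinct, so it has less
  than \<open>n (H + n + 1)\<close> steps. No jump leads from the source of one of its jumps to the target of a
  later one. Consequently the jumps that start on the same \<open>X\<close> visit disjoint subsets of
  \<open>Q \<times> \<int> / A X\<close>, at most \<open>A X\<close> jumps start on \<open>X\<close>, and at most \<open>gcd (A X) (B Y)\<close> jumps lead from
  \<open>X\<close> to \<open>Y\<close> (similarly for a fixed \<open>Y\<close>). As the cycles in each family have at most \<open>n\<close> states in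
  total, summing the costs of all jumps, pumping included, gives at most \<open>9 n\<^sup>2\<close>.
\<close>

type_synonym 'q edges = "('q \<times> int \<times> 'q) set"

section \<open>Walks and traces in the graph of transitions\<close>

primrec walk :: "'q edges \<Rightarrow> nat \<Rightarrow> 'q \<Rightarrow> int \<Rightarrow> 'q \<Rightarrow> bool" where
  "walk E 0 p e q \<longleftrightarrow> p = q \<and> e = 0"
| "walk E (Suc l) p e q \<longleftrightarrow> (\<exists>d r. (p, d, r) \<in> E \<and> walk E l r (e - d) q)"

lemma walk_append:
  "walk E l p e r \<Longrightarrow> walk E l' r e' q \<Longrightarrow> walk E (l + l') p (e + e') q"
proof (induction l arbitrary: p e)
  case (Suc l)
  then obtain d s where ds: "(p, d, s) \<in> E" "walk E l s (e - d) r" by auto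
  have "walk E (l + l') s (e - d + e') q" using Suc.IH[OF ds(2) Suc.prems(2)] .
  then show ?case using ds(1) by (auto simp: algebra_simps)
qed auto

lemma walk_mono: "E \<subseteq> E' \<Longrightarrow> walk E l p e q \<Longrightarrow> walk E' l p e q"
  by (induction l arbitrary: p e) (simp, force)

text \<open>Exposing states and counter values as functions of the index turns cutting and splicing
  of walks into index arithmetic. Only arguments up to \<open>N\<close> carry meaning.\<close>

definition trace :: "'q edges \<Rightarrow> nat \<Rightarrow> (nat \<Rightarrow> 'q) \<Rightarrow> (nat \<Rightarrow> int) \<Rightarrow> bool" where
  "trace E N v c \<longleftrightarrow> (\<forall>i<N. (v i, c (Suc i) - c i, v (Suc i)) \<in> E)"

lemma trace_walk:
  assumes "trace E N v c" "i \<le> j" "j \<le> N"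
  shows "walk E (j - i) (v i) (c j - c i) (v j)"
  using assms(2,3)
proof (induction j rule: dec_induct)
  case (step j)
  have "walk E 1 (v j) (c (Suc j) - c j) (v (Suc j))"
    using assms(1) step by (auto simp: trace_def)
  from walk_append[OF step.IH this] step show ?case by (simp add: Suc_diff_le)
qed simp

lemma walk_trace:
  "walk E l p e q \<Longrightarrow> \<exists>v c. trace E l v c \<and> v 0 = p \<and> c 0 = h \<and> v l = q \<and> c l = h + e"
proof (induction l arbitrary: p e h)
  case 0
  then show ?case by (intro exI[of _ "\<lambda>_. p"] exI[of _ "\<lambda>_. h"]) (auto simp: trace_def)
next
  case (Suc l)
  then obtain d r where dr: "(p, d, r) \<in> E" "walk E l r (e - d) q" by auto
  from Suc.IH[OF dr(2), of "h + d"] obtain v c where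
    vc: "trace E l v c" "v 0 = r" "c 0 = h + d" "v l = q" "c l = h + d + (e - d)" by blast
  show ?case
    using vc dr(1)
    by (intro exI[of _ "case_nat p v"] exI[of _ "case_nat h c"])
       (auto simp: trace_def less_Suc_eq_0_disj)
qed

lemma walk_abs_le:
  assumes "E \<subseteq> Q \<times> {-1,0,1} \<times> Q" "walk E l p e q"
  shows "\<bar>e\<bar> \<le> int l"
  using assms(2)
proof (induction l arbitrary: p e)
  case (Suc l)
  then obtain d r where dr: "(p, d, r) \<in> E" "walk E l r (e - d) q" by auto
  have "\<bar>d\<bar> \<le> 1" using assms(1) dr(1) by auto
  then show ?case using Suc.IH[OF dr(2)] by linarith
qed simp

lemma trace_states:
  assumes "E \<subseteq> Q \<times> D \<times> Q" "trace E N v c" "v N \<in> Q" "i \<le> N"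
  shows "v i \<in> Q"
proof (cases "i = N")
  case False
  then have "(v i, c (Suc i) - c i, v (Suc i)) \<in> E" using assms by (simp add: trace_def)
  then show ?thesis using assms(1) by blast
qed (use assms in simp)

section \<open>Positive cycles and maximal disjoint families of them\<close>

text \<open>Edges keep their direction, so a descending cycle of \<open>E\<close> is a positive
  cycle of \<open>neg E\<close>, and the results on positive cycles serve both families.\<close>

definition neg :: "'q edges \<Rightarrow> 'q edges" where
  "neg E = (\<lambda>(p, d, q). (p, - d, q)) ` E"

lemma neg_iff: "(p, d, q) \<in> neg E \<longleftrightarrow> (p, - d, q) \<in> E"
  by (force simp: neg_def)

lemma walk_neg: "walk (neg E) l p e q \<longleftrightarrow> walk E l p (- e) q"
proof (induction l arbitrary: p e)
  case (Suc l)
  have "walk (neg E) (Suc l) p e q \<longleftrightarrow> (\<exists>d r. (p, - d, r) \<in> E \<and> walk E l r (- (e - d)) q)"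
    using Suc.IH by (simp add: neg_iff)
  also have "\<dots> \<longleftrightarrow> (\<exists>d r. (p, d, r) \<in> E \<and> walk E l r (- e - d) q)"
    by (auto simp: algebra_simps) (metis add.inverse_inverse diff_conv_add_uminus minus_diff_eq uminus_add_conv_diff)+
  finally show ?case by simp
qed auto

text \<open>
  \<open>X\<close> is the state set of a simple cycle of effect \<open>a\<close>; \<open>pos s\<close> is the effect of the part of the
  cycle that leads from a fixed base state to \<open>s\<close>.
\<close>
definition cyc :: "'q edges \<Rightarrow> 'q set \<Rightarrow> int \<Rightarrow> ('q \<Rightarrow> int) \<Rightarrow> bool" where
  "cyc E X a pos \<longleftrightarrow> finite X \<and> X \<noteq> {} \<and> 0 < a \<and> (\<forall>s\<in>X. walk E (card X) s a s) \<and>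
     (\<forall>s\<in>X. \<forall>s'\<in>X. \<exists>l e. walk E l s e s' \<and> [e = pos s' - pos s] (mod a))"

lemma cyc_exists:
  assumes "walk E l p a p" "0 < a"
  shows "\<exists>X a pos. cyc E X a pos \<and> X \<subseteq> fst ` E"
proof -
  \<comment> \<open>A positive closed walk of minimal length is simple: of two shorter closed walks into which it
    splits, one would be positive.\<close>
  define P where "P l \<longleftrightarrow> (\<exists>p a. walk E l p a p \<and> 0 < a)" for l
  define m where "m = (LEAST l. P l)"
  have "P l" using assms P_def by blast
  then have "P m" unfolding m_def by (rule LeastI)
  then obtain p a where w: "walk E m p a p" "0 < a" using P_def by blast
  have least: "\<not> P k" if "k < m" for k using that not_less_Least unfolding m_def by blast
  have m0: "m > 0" using w by (cases m) auto
  obtain v c where t: "trace E m v c" "v 0 = p" "c 0 = 0" "v m = p" "c m = a"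
    using walk_trace[OF w(1), of 0] by auto
  have neq: "v i \<noteq> v j" if "i < j" "j < m" for i j
  proof
    assume eq: "v i = v j"
    have "walk E (j - i) (v i) (c j - c i) (v i)"
      using trace_walk[OF t(1), of i j] that eq by auto
    moreover have "walk E (i + (m - j)) p (c i + (a - c j)) p"
      using walk_append[of E i p "c i" "v i" "m - j" "a - c j" p]
        trace_walk[OF t(1), of 0 i] trace_walk[OF t(1), of j m] that eq t by auto
    moreover have "j - i < m" "i + (m - j) < m" using that by linarith+
    ultimately have "\<not> 0 < c j - c i" "\<not> 0 < c i + (a - c j)"
      using least unfolding P_def by blast+
    then show False using w(2) by linarith
  qed
  then have inj: "inj_on v {..<m}"
    by (metis (no_types, lifting) inj_onI lessThan_iff nat_neq_iff)
  define X where "X = v ` {..<m}"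
  define pos where "pos s = c (the_inv_into {..<m} v s)" for s
  have pos: "pos (v i) = c i" if "i < m" for i
    using that by (simp add: pos_def the_inv_into_f_f[OF inj])
  have card: "card X = m" unfolding X_def using card_image[OF inj] by simp
  have into: "walk E i p (c i) (v i)" and out: "walk E (m - i) (v i) (a - c i) p" if "i < m" for i
    using trace_walk[OF t(1), of 0 i] trace_walk[OF t(1), of i m] that t by auto
  \<comment> \<open>The cycle is rotated: out to the base state \<open>p\<close>, then back in to
    \<open>v i\<close>.\<close>
  have "walk E m (v i) a (v i)" if "i < m" for i
    using walk_append[OF out[OF that] into[OF that]] that by simp
  moreover have "\<exists>l e. walk E l (v i) e (v j) \<and> [e = pos (v j) - pos (v i)] (mod a)"
    if "i < m" "j < m" for i j
  proof -
    \<comment> \<open>The connection always runs through \<open>p\<close>, even for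
      \<open>i < j\<close>; the full turn this adds vanishes modulo \<open>a\<close>.\<close>
    have "[a - c i + c j = c j - c i] (mod a)" by (simp add: cong_iff_dvd_diff)
    then show ?thesis using walk_append[OF out[OF that(1)] into[OF that(2)]] that pos by auto
  qed
  ultimately have "cyc E X a pos"
    unfolding cyc_def card using m0 w(2) by (auto simp: X_def)
  moreover have "X \<subseteq> fst ` E"
    using t(1) by (force simp: X_def trace_def)
  ultimately show ?thesis by blast
qed

lemma cyc_mono: "E \<subseteq> E' \<Longrightarrow> cyc E X a pos \<Longrightarrow> cyc E' X a pos"
  unfolding cyc_def by (meson walk_mono)

text \<open>A family that is maximal under inclusion works: a positive closed walk whose edges all
  start outside \<open>\<Union>F\<close> would yield, by \<open>cyc_exists\<close>, a cycle on such
  sources, and this cycle could be added to \<open>F\<close>.\<close>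

lemma hitting_family:
  assumes "finite Q" "E \<subseteq> Q \<times> D \<times> Q"
  shows "\<exists>F A pos. F \<subseteq> Pow Q \<and> disjoint F \<and> (\<forall>X\<in>F. cyc E X (A X) (pos X)) \<and>
    (\<forall>l p a. walk {t \<in> E. fst t \<notin> \<Union>F} l p a p \<longrightarrow> a \<le> 0)"
proof -
  define P where "P F \<longleftrightarrow> F \<subseteq> Pow Q \<and> disjoint F \<and> (\<forall>X\<in>F. \<exists>a pos. cyc E X a pos)" for F
  have "finite {F. P F}"
    by (rule finite_subset[of _ "Pow (Pow Q)"]) (use assms(1) in \<open>auto simp: P_def\<close>)
  moreover have "P {}" by (simp add: P_def)
  ultimately obtain F where F: "P F" and max: "\<And>F'. P F' \<Longrightarrow> F \<subseteq> F' \<Longrightarrow> F' = F"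
    using finite_has_maximal[of "{F. P F}"] by (metis empty_iff mem_Collect_eq)
  have "a \<le> 0" if w: "walk {t \<in> E. fst t \<notin> \<Union>F} l p a p" for l p a
  proof (rule ccontr)
    assume "\<not> a \<le> 0"
    then obtain X a' pos where X: "cyc {t \<in> E. fst t \<notin> \<Union>F} X a' pos"
      "X \<subseteq> fst ` {t \<in> E. fst t \<notin> \<Union>F}" using cyc_exists[OF w] by auto
    have "cyc E X a' pos" using cyc_mono[OF _ X(1), of E] by auto
    moreover have "X \<inter> \<Union>F = {}" "X \<subseteq> Q" using X(2) assms(2) by fastforce+
    \<comment> \<open>Without this, disjointness from \<open>\<Union>F\<close> would not exclude
      \<open>X \<in> F\<close>.\<close>
    moreover have "X \<noteq> {}" using X(1) by (simp add: cyc_def)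
    ultimately have "P (insert X F)" "X \<notin> F"
      using F unfolding P_def by (auto simp: disjoint_def)
    then show False using max by blast
  qed
  moreover obtain A pos where "\<forall>X\<in>F. cyc E X (A X) (pos X)" using F unfolding P_def by metis
  ultimately show ?thesis using F unfolding P_def by blast
qed

text \<open>Cutting out the closed segment between two visits to a state does not lower the effect.
  This reduces the claim to walks of fewer than \<open>card Q\<close> edges, each of effect at most
  1.\<close>

lemma walk_bound:
  assumes "finite Q" "E \<subseteq> Q \<times> {-1,0,1} \<times> Q" "\<And>l p a. walk E l p a p \<Longrightarrow> a \<le> 0"
    and "walk E l p e q" "q \<in> Q"
  shows "e < int (card Q)"
  using assms(4)
proof (induction l arbitrary: e rule: less_induct)
  case (less l)
  show ?case
  proof (cases "l < card Q")
    case True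
    then show ?thesis using walk_abs_le[OF assms(2) less.prems] by linarith
  next
    case False
    obtain v c where t: "trace E l v c" "v 0 = p" "c 0 = 0" "v l = q" "c l = e"
      using walk_trace[OF less.prems, of 0] by auto
    have "v ` {..l} \<subseteq> Q" using trace_states[OF assms(2) t(1)] t(4) assms(5) by auto
    then have "card (v ` {..l}) < card {..l}"
      using card_mono[OF assms(1)] False by (metis card_atMost le_imp_less_Suc not_less order_trans)
    then have "\<not> inj_on v {..l}" by (rule pigeonhole)
    then obtain i j where ij: "i < j" "j \<le> l" "v i = v j"
      by (metis atMost_iff inj_onI nat_neq_iff)
    have "walk E (j - i) (v i) (c j - c i) (v i)"
      using trace_walk[OF t(1), of i j] ij by auto
    then have "c j - c i \<le> 0" by (rule assms(3))
    moreover have "walk E (i + (l - j)) p (c i + (e - c j)) q"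
      using walk_append[of E i p "c i" "v i" "l - j" "e - c j" q]
        trace_walk[OF t(1), of 0 i] trace_walk[OF t(1), of j l] ij t by auto
    then have "c i + (e - c j) < int (card Q)"
      using less.IH[of "i + (l - j)"] ij by auto
    ultimately show ?thesis by linarith
  qed
qed

section \<open>Simple walks, pumping and counting modulo g\<close>

text \<open>A shortest walk with effect in the required class works: if a state recurred with the
  same counter residue, cutting out the segment in between would keep the class.\<close>

lemma simple_trace_mod:
  assumes "walk E l p e q" "[e = k - h] (mod g)"
  shows "\<exists>N v c. trace E N v c \<and> v 0 = p \<and> c 0 = h \<and> v N = q \<and> [c N = k] (mod g) \<and>
    (\<forall>i\<le>N. \<forall>j\<le>N. v i = v j \<longrightarrow> [c i = c j] (mod g) \<longrightarrow> i = j)"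
proof -
  define P where "P l \<longleftrightarrow> (\<exists>e. walk E l p e q \<and> [e = k - h] (mod g))" for l
  define N where "N = (LEAST l. P l)"
  have "P l" using assms P_def by blast
  then have "P N" unfolding N_def by (rule LeastI)
  then obtain e where w: "walk E N p e q" "[e = k - h] (mod g)" using P_def by blast
  have least: "\<not> P k" if "k < N" for k using that not_less_Least unfolding N_def by blast
  obtain v c where t: "trace E N v c" "v 0 = p" "c 0 = h" "v N = q" "c N = h + e"
    using walk_trace[OF w(1), of h] by auto
  have *: False if "i < j" "j \<le> N" "v i = v j" "[c i = c j] (mod g)" for i j
  proof -
    have "walk E (i + (N - j)) p (c i - h + (h + e - c j)) q"
      using walk_append[of E i p "c i - h" "v i" "N - j" "h + e - c j" q]
        trace_walk[OF t(1), of 0 i] trace_walk[OF t(1), of j N] that t by auto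
    moreover have "[c i - h + (h + e - c j) = k - h] (mod g)"
      using cong_add[OF w(2) cong_diff[OF that(4) cong_refl[of "c j"]]] by (simp add: algebra_simps)
    ultimately show False using least[of "i + (N - j)"] that unfolding P_def by auto
  qed
  have "[c N = k] (mod g)"
    using cong_add[OF cong_refl[of h] w(2)] t(5) by simp
  then show ?thesis using t * by (metis cong_sym nat_neq_iff)
qed

text \<open>Adding a multiple of \<open>b div gcd a b\<close> to a solution of
  \<open>x * a = D\<close> modulo \<open>b\<close> gives another one, so some solution lies among
  any \<open>b div gcd a b\<close> consecutive integers, in particular just above
  \<open>M / a\<close>.\<close>

lemma pump_count:
  fixes a b D M :: int
  assumes "0 < a" "0 < b" "gcd a b dvd D" "0 \<le> M"
  shows "\<exists>x\<ge>0. b dvd x * a - D \<and> M \<le> x * a \<and> x * a \<le> M + a * (b div gcd a b)"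
proof -
  define r where "r = b div gcd a b"
  have r: "0 < r" unfolding r_def using assms by (simp add: pos_imp_zdiv_pos_iff zdvd_imp_le)
  obtain x0 where x0: "[a * x0 = D] (mod b)"
  proof -
    obtain x1 where "[a * x1 = gcd a b] (mod b)" using cong_solve_int by blast
    moreover obtain m where "D = gcd a b * m" using assms(3) by auto
    ultimately have "[a * (x1 * m) = D] (mod b)" using cong_mult[OF _ cong_refl[of m]]
      by (metis mult.assoc)
    then show ?thesis using that by blast
  qed
  \<comment> \<open>\<open>q\<close> is \<open>M / a\<close> rounded up, and \<open>x\<close> is the
    first number from \<open>q\<close> on that is congruent to \<open>x0\<close> modulo
    \<open>r\<close>.\<close>
  define q where "q = (M + a - 1) div a"
  define x where "x = q + (x0 - q) mod r"
  have q: "0 \<le> q" unfolding q_def using assms by (simp add: pos_imp_zdiv_nonneg_iff)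
  have qa: "q * a + (M + a - 1) mod a = M + a - 1" unfolding q_def by simp
  have qa': "0 \<le> (M + a - 1) mod a" "(M + a - 1) mod a < a" using assms by auto
  have m: "0 \<le> (x0 - q) mod r" "(x0 - q) mod r \<le> r - 1" using r by (auto simp: int_one_le_iff_zero_less pos_mod_bound)
  have "q * a \<le> x * a" unfolding x_def using m assms by simp
  moreover have "x * a \<le> (q + (r - 1)) * a" unfolding x_def using m assms by simp
  moreover have "b dvd x * a - D"
  proof -
    have "b dvd a * r" unfolding r_def
      by (metis dvd_div_mult gcd_dvd1 gcd_dvd2 div_mult_swap dvd_triv_right)
    moreover have "r dvd x - x0" unfolding x_def
      by (metis add.commute diff_diff_eq2 dvd_minus_mod dvd_diff_commute)
    then have "a * r dvd a * (x - x0)" by simp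
    ultimately have "b dvd a * (x - x0)" by (rule dvd_trans)
    moreover have "b dvd a * x0 - D" using x0 by (simp add: cong_iff_dvd_diff)
    ultimately have "b dvd a * (x - x0) + (a * x0 - D)" by (rule dvd_add)
    then show ?thesis by (simp add: algebra_simps)
  qed
  moreover have "0 \<le> x" using q m by (simp add: x_def)
  \<comment> \<open>The term \<open>- a\<close> pays for the rounding in \<open>q\<close>, which
    costs at most \<open>a - 1\<close>.\<close>
  moreover have "(q + (r - 1)) * a = q * a + a * r - a" by (simp add: algebra_simps)
  ultimately have "0 \<le> x \<and> b dvd x * a - D \<and> M \<le> x * a \<and> x * a \<le> M + a * r"
    using qa qa' by linarith
  then show ?thesis unfolding r_def by blast
qed


lemma count_residues:
  fixes \<rho> :: "nat \<Rightarrow> int"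
  assumes "0 < g" "\<And>i j. i \<in> I \<Longrightarrow> j \<in> I \<Longrightarrow> i < j \<Longrightarrow> \<not> [\<rho> i = \<rho> j] (mod g)"
  shows "int (card I) \<le> g"
proof -
  have "inj_on (\<lambda>i. \<rho> i mod g) I"
    using assms(2) by (intro inj_onI) (metis cong_def nat_neq_iff)
  moreover have "(\<lambda>i. \<rho> i mod g) ` I \<subseteq> {0..<g}" using assms(1) by auto
  ultimately have "card I \<le> card {0..<g}" by (intro card_inj_on_le) auto
  then show ?thesis using assms(1) by simp
qed

text \<open>The pairs of state and counter residue met along all traces are distinct. Trace
  \<open>i\<close> contributes \<open>N i + 1\<close> of them, and only \<open>card Q * g\<close>
  exist.\<close>

lemma count_vertices:
  fixes c :: "nat \<Rightarrow> nat \<Rightarrow> int"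
  assumes "finite I" "finite Q" "0 < g"
    and "\<And>i k. i \<in> I \<Longrightarrow> k \<le> N i \<Longrightarrow> v i k \<in> Q"
    and inj: "\<And>i k k'. i \<in> I \<Longrightarrow> k \<le> N i \<Longrightarrow> k' \<le> N i \<Longrightarrow> v i k = v i k' \<Longrightarrow>
      [c i k = c i k'] (mod g) \<Longrightarrow> k = k'"
    and disj: "\<And>i j k k'. i \<in> I \<Longrightarrow> j \<in> I \<Longrightarrow> i < j \<Longrightarrow> k \<le> N i \<Longrightarrow> k' \<le> N j \<Longrightarrow>
      v i k = v j k' \<Longrightarrow> \<not> [c i k = c j k'] (mod g)"
  shows "(\<Sum>i\<in>I. int (N i)) \<le> int (card Q) * g"
proof -
  define f where "f = (\<lambda>(i, k). (v i k, c i k mod g))"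
  have "inj_on f (Sigma I (\<lambda>i. {..N i}))"
  proof (rule inj_onI)
    fix x y
    assume xy: "x \<in> Sigma I (\<lambda>i. {..N i})" "y \<in> Sigma I (\<lambda>i. {..N i})" "f x = f y"
    obtain i k j k' where xyk: "x = (i, k)" "y = (j, k')" by (cases x, cases y)
    then have ij: "i \<in> I" "j \<in> I" "k \<in> {..N i}" "k' \<in> {..N j}" "f (i, k) = f (j, k')"
      using xy by auto
    then have eq: "v i k = v j k'" "[c i k = c j k'] (mod g)" by (auto simp: f_def cong_def)
    have "i = j" using disj[of i j k k'] disj[of j i k' k] ij eq
      by (metis atMost_iff cong_sym nat_neq_iff)
    then show "x = y" using inj[of i k k'] ij eq xyk by auto
  qed
  moreover have "f ` (Sigma I (\<lambda>i. {..N i})) \<subseteq> Q \<times> {0..<g}"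
    using assms(3,4) by (auto simp: f_def)
  ultimately have "card (Sigma I (\<lambda>i. {..N i})) \<le> card (Q \<times> {0..<g})"
    using assms(2) by (intro card_inj_on_le) auto
  then have "(\<Sum>i\<in>I. N i + 1) \<le> card Q * nat g"
    using assms(1) by (simp add: card_cartesian_product)
  then have "int (\<Sum>i\<in>I. N i + 1) \<le> int (card Q) * g"
    using assms(3) by (metis of_nat_mono of_nat_mult nat_0_le less_imp_le)
  moreover have "(\<Sum>i\<in>I. int (N i)) \<le> (\<Sum>i\<in>I. int (N i + 1))" by (intro sum_mono) auto
  ultimately show ?thesis by simp
qed

section \<open>Counting the jumps of a shortest sequence\<close>

text \<open>Isolates what the counting needs: jump \<open>i\<close> leads from
  \<open>(s i, h i)\<close> to \<open>(t i, k i)\<close>, and indices are positions in the shortest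
  sequence. By \<open>chordless\<close>, no jump skips from the source of one jump to the target of
  a later one.\<close>

locale jump_system =
  fixes Q :: "'q set" and E :: "'q edges" and F G :: "'q set set" and A B :: "'q set \<Rightarrow> int"
    and P R :: "'q set \<Rightarrow> 'q \<Rightarrow> int" and I :: "nat set" and X Y :: "nat \<Rightarrow> 'q set"
    and s t :: "nat \<Rightarrow> 'q" and h k :: "nat \<Rightarrow> int"
  assumes finQ: "finite Q" and EQ: "E \<subseteq> Q \<times> {-1,0,1} \<times> Q" and finI: "finite I"
    and F: "F \<subseteq> Pow Q" "disjoint F" and G: "G \<subseteq> Pow Q" "disjoint G"
    and cycF: "\<And>Z. Z \<in> F \<Longrightarrow> cyc E Z (A Z) (P Z)"
    and cycG: "\<And>Z. Z \<in> G \<Longrightarrow> cyc (neg E) Z (B Z) (R Z)"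
    and X: "\<And>i. i \<in> I \<Longrightarrow> X i \<in> F \<and> s i \<in> X i"
    and Y: "\<And>i. i \<in> I \<Longrightarrow> Y i \<in> G \<and> t i \<in> Y i"
    and jump: "\<And>i. i \<in> I \<Longrightarrow>
      \<exists>l e. walk E l (s i) e (t i) \<and> [e = k i - h i] (mod gcd (A (X i)) (B (Y i)))"
    and chordless: "\<And>i j l e. i \<in> I \<Longrightarrow> j \<in> I \<Longrightarrow> i < j \<Longrightarrow> walk E l (s i) e (t j) \<Longrightarrow>
      \<not> [e = k j - h i] (mod gcd (A (X i)) (B (Y j)))"
begin

lemma A_pos: "i \<in> I \<Longrightarrow> 0 < A (X i)" and B_pos: "i \<in> I \<Longrightarrow> 0 < B (Y i)"
  using cycF cycG X Y unfolding cyc_def by blast+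

text \<open>\<open>h i - P Z (s i)\<close> is the counter value after sliding back along
  \<open>Z\<close> to its base. If it agreed modulo \<open>g\<close> for \<open>i < j\<close>, the
  arc from \<open>s i\<close> to \<open>s j\<close> followed by jump \<open>j\<close> would be a
  chord. Later \<open>g\<close> is \<open>A Z\<close>, for all jumps from \<open>Z\<close>, or
  \<open>gcd (A Z) (B Z')\<close>, for those from \<open>Z\<close> to \<open>Z'\<close>.\<close>

lemma card_source:
  assumes "0 < g" "J \<subseteq> I" "\<And>i. i \<in> J \<Longrightarrow> X i = Z"
    and g: "\<And>i. i \<in> J \<Longrightarrow> gcd (A Z) (B (Y i)) dvd g"
  shows "int (card J) \<le> g"
proof (rule count_residues[OF assms(1), where \<rho> = "\<lambda>i. h i - P Z (s i)"])
  fix i j assume ij: "i \<in> J" "j \<in> J" "i < j"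
  then have I: "i \<in> I" "j \<in> I" and Xij: "X i = Z" "X j = Z" using assms by auto
  let ?g = "gcd (A Z) (B (Y j))"
  show "\<not> [h i - P Z (s i) = h j - P Z (s j)] (mod g)"
  proof
    assume "[h i - P Z (s i) = h j - P Z (s j)] (mod g)"
    then have 1: "[h i - P Z (s i) = h j - P Z (s j)] (mod ?g)"
      using g[OF ij(2)] by (rule cong_dvd_modulus)
    obtain l e where le: "walk E l (s i) e (s j)" "[e = P Z (s j) - P Z (s i)] (mod A Z)"
      using cycF[of Z] X[OF I(1)] X[OF I(2)] Xij unfolding cyc_def by blast
    have 2: "[e = P Z (s j) - P Z (s i)] (mod ?g)" using le(2) by (rule cong_dvd_modulus) simp
    obtain l' e' where le': "walk E l' (s j) e' (t j)" "[e' = k j - h j] (mod ?g)"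
      using jump[OF I(2)] Xij by auto
    have "[e + e' = k j - h i] (mod ?g)"
      using dvd_add[OF dvd_add[OF 2[unfolded cong_iff_dvd_diff] le'(2)[unfolded cong_iff_dvd_diff]]
          1[unfolded cong_iff_dvd_diff]]
      by (simp add: cong_iff_dvd_diff algebra_simps)
    then show False using chordless[OF I ij(3) walk_append[OF le(1) le'(1)]] Xij by simp
  qed
qed

text \<open>Dual to \<open>card_source\<close>: the chord is jump \<open>i\<close> followed by the
  arc of \<open>Z\<close> from \<open>t i\<close> to \<open>t j\<close>. The sign of
  \<open>R\<close> is positive since \<open>R\<close> measures effects in
  \<open>neg E\<close>.\<close>

lemma card_target:
  assumes "J \<subseteq> I" "\<And>i. i \<in> J \<Longrightarrow> Y i = Z" "Z \<in> G"
  shows "int (card J) \<le> B Z"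
proof (rule count_residues[where \<rho> = "\<lambda>i. k i + R Z (t i)"])
  show "0 < B Z" using cycG[OF assms(3)] by (simp add: cyc_def)
  fix i j assume ij: "i \<in> J" "j \<in> J" "i < j"
  then have I: "i \<in> I" "j \<in> I" and Yij: "Y i = Z" "Y j = Z" using assms by auto
  let ?g = "gcd (A (X i)) (B Z)"
  show "\<not> [k i + R Z (t i) = k j + R Z (t j)] (mod B Z)"
  proof
    assume "[k i + R Z (t i) = k j + R Z (t j)] (mod B Z)"
    then have 1: "[k i + R Z (t i) = k j + R Z (t j)] (mod ?g)"
      by (rule cong_dvd_modulus) simp
    obtain l e where le: "walk (neg E) l (t i) e (t j)" "[e = R Z (t j) - R Z (t i)] (mod B Z)"
      using cycG[of Z] Y[OF I(1)] Y[OF I(2)] Yij unfolding cyc_def by blast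
    have 2: "[e = R Z (t j) - R Z (t i)] (mod ?g)" using le(2) by (rule cong_dvd_modulus) simp
    have w: "walk E l (t i) (- e) (t j)" using le(1) by (simp add: walk_neg)
    obtain l' e' where le': "walk E l' (s i) e' (t i)" "[e' = k i - h i] (mod ?g)"
      using jump[OF I(1)] Yij by auto
    have "[e' + - e = k j - h i] (mod ?g)"
      using dvd_add[OF dvd_diff[OF le'(2)[unfolded cong_iff_dvd_diff] 2[unfolded cong_iff_dvd_diff]]
          1[unfolded cong_iff_dvd_diff]]
      by (simp add: cong_iff_dvd_diff algebra_simps)
    then show False using chordless[OF I ij(3) walk_append[OF le'(1) w]] Yij by simp
  qed
qed

text \<open>Each jump gets a walk that is simple modulo its gcd. If the walks of two jumps from the
  same \<open>Z\<close> met in a state with counters congruent modulo \<open>A Z\<close>, a prefix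
  of the earlier and a suffix of the later would join to a chord. Hence
  \<open>count_vertices\<close> applies, and similarly for a common target cycle.\<close>

lemma short_walks:
  "\<exists>N. (\<forall>i\<in>I. \<exists>f. walk E (N i) (s i) f (t i) \<and> [f = k i - h i] (mod gcd (A (X i)) (B (Y i)))) \<and>
    (\<forall>Z\<in>F. (\<Sum>i | i \<in> I \<and> X i = Z. int (N i)) \<le> int (card Q) * A Z) \<and>
    (\<forall>Z\<in>G. (\<Sum>i | i \<in> I \<and> Y i = Z. int (N i)) \<le> int (card Q) * B Z)"
proof -
  let ?g = "\<lambda>i. gcd (A (X i)) (B (Y i))"
  have "\<forall>i\<in>I. \<exists>N v c. trace E N v c \<and> v 0 = s i \<and> c 0 = h i \<and> v N = t i \<and> [c N = k i] (mod ?g i) \<and>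
    (\<forall>m\<le>N. \<forall>m'\<le>N. v m = v m' \<longrightarrow> [c m = c m'] (mod ?g i) \<longrightarrow> m = m')"
    using jump simple_trace_mod by meson
  then obtain N v c where tr: "\<And>i. i \<in> I \<Longrightarrow> trace E (N i) (v i) (c i)"
    and ends: "\<And>i. i \<in> I \<Longrightarrow> v i 0 = s i \<and> c i 0 = h i \<and> v i (N i) = t i \<and> [c i (N i) = k i] (mod ?g i)"
    and simple: "\<And>i m m'. i \<in> I \<Longrightarrow> m \<le> N i \<Longrightarrow> m' \<le> N i \<Longrightarrow> v i m = v i m' \<Longrightarrow>
      [c i m = c i m'] (mod ?g i) \<Longrightarrow> m = m'"
    by metis
  have vQ: "v i m \<in> Q" if "i \<in> I" "m \<le> N i" for i m
    using trace_states[OF EQ tr[OF that(1)] _ that(2)] ends[OF that(1)] Y[OF that(1)] G by auto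
  have pre: "walk E m (s i) (c i m - h i) (v i m)"
    and suf: "walk E (N i - m) (v i m) (c i (N i) - c i m) (t i)" if "i \<in> I" "m \<le> N i" for i m
    using trace_walk[OF tr[OF that(1)], of 0 m] trace_walk[OF tr[OF that(1)], of m "N i"]
      ends[OF that(1)] that by auto
  \<comment> \<open>The left side is the final counter value when the walk of \<open>i\<close> is
    followed up to step \<open>m\<close> and continued by the rest of the walk of
    \<open>j\<close>.\<close>
  have splice: "\<not> [c i m + c j (N j) - c j m' = k j] (mod gcd (A (X i)) (B (Y j)))"
    if "i \<in> I" "j \<in> I" "i < j" "m \<le> N i" "m' \<le> N j" "v i m = v j m'" for i j m m'
  proof
    assume *: "[c i m + c j (N j) - c j m' = k j] (mod gcd (A (X i)) (B (Y j)))"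
    have "walk E (m + (N j - m')) (s i) (c i m - h i + (c j (N j) - c j m')) (t j)"
      using walk_append[OF pre[OF that(1,4)], of "N j - m'"] suf[OF that(2,5)] that(6) by simp
    from chordless[OF that(1-3) this] cong_diff[OF * cong_refl[of "h i"]]
    show False by (simp add: algebra_simps)
  qed
  have "(\<Sum>i | i \<in> I \<and> X i = Z. int (N i)) \<le> int (card Q) * A Z" if "Z \<in> F" for Z
  proof (rule count_vertices[where v = v and c = c])
    show "0 < A Z" using cycF[OF that] by (simp add: cyc_def)
    show "m = m'" if "i \<in> {i \<in> I. X i = Z}" "m \<le> N i" "m' \<le> N i" "v i m = v i m'"
      "[c i m = c i m'] (mod A Z)" for i m m'
      using that by (intro simple[of i]) (auto elim: cong_dvd_modulus)
    fix i j m m'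
    assume ij: "i \<in> {i \<in> I. X i = Z}" "j \<in> {i \<in> I. X i = Z}" "i < j" "m \<le> N i" "m' \<le> N j"
      "v i m = v j m'"
    show "\<not> [c i m = c j m'] (mod A Z)"
    proof
      assume "[c i m = c j m'] (mod A Z)"
      \<comment> \<open>As \<open>X i = X j = Z\<close>, the modulus \<open>?g j\<close> divides
        \<open>A Z\<close> and is also that of a jump from \<open>s i\<close> to
        \<open>t j\<close>.\<close>
      then have "[c i m = c j m'] (mod ?g j)" using ij by (auto elim: cong_dvd_modulus)
      moreover have "[c j (N j) = k j] (mod ?g j)" using ends[of j] ij by auto
      ultimately have "[c i m + c j (N j) - c j m' = c j m' + k j - c j m'] (mod ?g j)"
        by (intro cong_add cong_diff cong_refl)
      then show False using splice[of i j m m'] ij by auto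
    qed
  qed (use finI finQ vQ in auto)
  moreover have "(\<Sum>i | i \<in> I \<and> Y i = Z. int (N i)) \<le> int (card Q) * B Z" if "Z \<in> G" for Z
  \<comment> \<open>The counter is now aligned with the target of the jump, since it has to be compared modulo \<open>B Z\<close>
    whereas the walk meets its target only modulo \<open>?g i\<close>.\<close>
  proof (rule count_vertices[where v = v and c = "\<lambda>i m. k i - c i (N i) + c i m"])
    show "0 < B Z" using cycG[OF that] by (simp add: cyc_def)
    show "m = m'" if "i \<in> {i \<in> I. Y i = Z}" "m \<le> N i" "m' \<le> N i" "v i m = v i m'"
      "[k i - c i (N i) + c i m = k i - c i (N i) + c i m'] (mod B Z)" for i m m'
    proof -
      have "[c i m = c i m'] (mod B Z)" using that(5) by (simp add: cong_iff_dvd_diff)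
      then show ?thesis using that by (intro simple[of i]) (auto elim: cong_dvd_modulus)
    qed
    fix i j m m'
    assume ij: "i \<in> {i \<in> I. Y i = Z}" "j \<in> {i \<in> I. Y i = Z}" "i < j" "m \<le> N i" "m' \<le> N j"
      "v i m = v j m'"
    show "\<not> [k i - c i (N i) + c i m = k j - c j (N j) + c j m'] (mod B Z)"
    proof
      assume "[k i - c i (N i) + c i m = k j - c j (N j) + c j m'] (mod B Z)"
      then have 1: "[k i - c i (N i) + c i m = k j - c j (N j) + c j m'] (mod ?g i)"
        using ij by (auto elim: cong_dvd_modulus)
      have 2: "[c i (N i) = k i] (mod ?g i)" using ends[of i] ij by auto
      have "[c i (N i) + (k i - c i (N i) + c i m) + (c j (N j) - c j m' - k i) =
        k i + (k j - c j (N j) + c j m') + (c j (N j) - c j m' - k i)] (mod ?g i)"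
        using cong_add[OF cong_add[OF 2 1] cong_refl] .
      then have "[c i m + c j (N j) - c j m' = k j] (mod ?g i)" by (simp add: algebra_simps)
      then show False using splice[of i j m m'] ij by auto
    qed
  qed (use finI finQ vQ in auto)
  moreover have "\<exists>f. walk E (N i) (s i) f (t i) \<and> [f = k i - h i] (mod ?g i)" if "i \<in> I" for i
  proof -
    have "walk E (N i) (s i) (c i (N i) - h i) (t i)"
      using pre[OF that, of "N i"] ends[OF that] by auto
    moreover have "[c i (N i) - h i = k i - h i] (mod ?g i)"
      using ends[OF that] by (intro cong_diff) auto
    ultimately show ?thesis by blast
  qed
  ultimately show ?thesis by blast
qed


section \<open>Summing the costs of all jumps\<close>

lemma sum_cards: "(\<Sum>Z\<in>F. card Z) \<le> card Q" "(\<Sum>Z\<in>G. card Z) \<le> card Q"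
proof -
  have "(\<Sum>Z\<in>K. card Z) \<le> card Q" if "K \<subseteq> Pow Q" "disjoint K" for K
  proof -
    have "card (\<Union>K) = (\<Sum>Z\<in>K. card Z)"
      using that finQ by (intro card_Union_disjoint) (auto simp: pairwise_def disjnt_def disjoint_def intro: finite_subset)
    moreover have "card (\<Union>K) \<le> card Q" using that finQ by (intro card_mono) auto
    ultimately show ?thesis by simp
  qed
  then show "(\<Sum>Z\<in>F. card Z) \<le> card Q" "(\<Sum>Z\<in>G. card Z) \<le> card Q" using F G by blast+
qed

lemma A_le_card: "Z \<in> F \<Longrightarrow> A Z \<le> int (card Z)"
  using cycF[of Z] walk_abs_le[OF EQ] unfolding cyc_def by fastforce

lemma B_le_card: "Z \<in> G \<Longrightarrow> B Z \<le> int (card Z)"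
proof -
  assume "Z \<in> G"
  then obtain s where "walk (neg E) (card Z) s (B Z) s" using cycG unfolding cyc_def by blast
  then show ?thesis using walk_abs_le[OF EQ] unfolding walk_neg by fastforce
qed

text \<open>Handles cost terms whose weight depends only on a cycle of the jump, or on its pair of
  cycles, when the rest is bounded for each class.\<close>

lemma grouped_sum_le:
  fixes u :: "nat \<Rightarrow> real"
  assumes "finite K" "\<kappa> ` I \<subseteq> K" "\<And>z. z \<in> K \<Longrightarrow> 0 \<le> w z"
    and "\<And>z. z \<in> K \<Longrightarrow> (\<Sum>i | i \<in> I \<and> \<kappa> i = z. u i) \<le> U z"
  shows "(\<Sum>i\<in>I. w (\<kappa> i) * u i) \<le> (\<Sum>z\<in>K. w z * U z)"
proof -
  have "(\<Sum>i\<in>I. w (\<kappa> i) * u i) = (\<Sum>z\<in>K. \<Sum>i | i \<in> I \<and> \<kappa> i = z. w (\<kappa> i) * u i)"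
    by (rule sum.group[OF finI assms(1,2), symmetric])
  also have "\<dots> = (\<Sum>z\<in>K. w z * (\<Sum>i | i \<in> I \<and> \<kappa> i = z. u i))"
    by (intro sum.cong refl) (auto simp: sum_distrib_left)
  also have "\<dots> \<le> (\<Sum>z\<in>K. w z * U z)"
    by (intro sum_mono mult_left_mono assms)
  finally show ?thesis .
qed

lemma finF: "finite F" and finG: "finite G"
  using F G finQ by (meson finite_Pow_iff finite_subset)+

lemma cost_bound:
  fixes n :: nat and x y :: "nat \<Rightarrow> nat"
  defines "n \<equiv> card Q"
  assumes NF: "\<And>Z. Z \<in> F \<Longrightarrow> (\<Sum>i | i \<in> I \<and> X i = Z. int (N i)) \<le> int n * A Z"
    and NG: "\<And>Z. Z \<in> G \<Longrightarrow> (\<Sum>i | i \<in> I \<and> Y i = Z. int (N i)) \<le> int n * B Z"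
    and x: "\<And>i. i \<in> I \<Longrightarrow> int (x i) * A (X i) \<le>
      int (N i + n) + A (X i) * (B (Y i) div gcd (A (X i)) (B (Y i)))"
    and y: "\<And>i. i \<in> I \<Longrightarrow> int (y i) * B (Y i) \<le>
      2 * int (N i + n) + A (X i) * (B (Y i) div gcd (A (X i)) (B (Y i)))"
  shows "(\<Sum>i\<in>I. x i * card (X i) + N i + y i * card (Y i)) \<le> 9 * n\<^sup>2"
proof -
  let ?g = "\<lambda>X Y. real_of_int (gcd (A X) (B Y))"
  have posF: "0 < A Z" if "Z \<in> F" for Z using cycF[OF that] by (simp add: cyc_def)
  have posG: "0 < B Z" if "Z \<in> G" for Z using cycG[OF that] by (simp add: cyc_def)
  have XF: "X ` I \<subseteq> F" and YG: "Y ` I \<subseteq> G" using X Y by auto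
  have sF: "(\<Sum>Z\<in>F. real (card Z)) \<le> n" and sG: "(\<Sum>Z\<in>G. real (card Z)) \<le> n"
    using sum_cards unfolding n_def by (metis of_nat_le_iff of_nat_sum)+
  \<comment> \<open>The walks contribute \<open>n * D\<close>; the summand \<open>n\<close>, taken
    for at most \<open>D\<close> jumps, contributes as much again.\<close>
  have split: "(\<Sum>i | i \<in> I \<and> \<kappa> i = Z. real (N i) + n) \<le> 2 * real n * real_of_int D"
    if "(\<Sum>i | i \<in> I \<and> \<kappa> i = Z. int (N i)) \<le> int n * D" "int (card {i \<in> I. \<kappa> i = Z}) \<le> D"
    for \<kappa> :: "nat \<Rightarrow> 'q set" and Z and D :: int
  proof -
    have "real_of_int (\<Sum>i | i \<in> I \<and> \<kappa> i = Z. int (N i)) \<le> real_of_int (int n * D)"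
      using that(1) by (simp only: of_int_le_iff)
    moreover have "real_of_int (int (card {i \<in> I. \<kappa> i = Z})) \<le> real_of_int D"
      using that(2) by (simp only: of_int_le_iff)
    then have "real (card {i \<in> I. \<kappa> i = Z}) * real n \<le> real_of_int D * real n" by (intro mult_right_mono) auto
    ultimately show ?thesis by (simp add: sum.distrib algebra_simps)
  qed
  have cX: "(\<Sum>i | i \<in> I \<and> X i = Z. real (N i) + n) \<le> 2 * real n * real_of_int (A Z)" if "Z \<in> F" for Z
    by (intro split NF that card_source[where Z = Z] posF) auto
  have cY: "(\<Sum>i | i \<in> I \<and> Y i = Z. real (N i) + n) \<le> 2 * real n * real_of_int (B Z)" if "Z \<in> G" for Z
    by (intro split NG that card_target) auto
  have cXY: "real (card {i \<in> I. (X i, Y i) = (Z, Z')}) \<le> ?g Z Z'" if "Z \<in> F" for Z Z'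
  proof -
    have "int (card {i \<in> I. (X i, Y i) = (Z, Z')}) \<le> gcd (A Z) (B Z')"
      by (rule card_source[where Z = Z]) (use posF[OF that] in auto)
    then show ?thesis by linarith
  qed
  have xr: "real (x i) \<le> (N i + n) / A (X i) + B (Y i) / ?g (X i) (Y i)"
    and yr: "real (y i) \<le> 2 * (N i + n) / B (Y i) + A (X i) / ?g (X i) (Y i)" if "i \<in> I" for i
  proof -
    have a: "0 < real_of_int (A (X i))" and b: "0 < real_of_int (B (Y i))"
      using A_pos[OF that] B_pos[OF that] by auto
    have d: "real_of_int (B (Y i) div gcd (A (X i)) (B (Y i))) = B (Y i) / ?g (X i) (Y i)"
      by (rule real_of_int_div) simp
    have le: "z \<le> u / w + v" if "z * w \<le> u + w * v" "0 < w" for z u v w :: real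
      using that by (simp add: field_simps)
    have "real_of_int (int (x i) * A (X i)) \<le>
      real_of_int (int (N i + n) + A (X i) * (B (Y i) div gcd (A (X i)) (B (Y i))))"
      using x[OF that] by (simp only: of_int_le_iff)
    then show "real (x i) \<le> (N i + n) / A (X i) + B (Y i) / ?g (X i) (Y i)"
      using a d by (intro le) simp_all
    have "real_of_int (int (y i) * B (Y i)) \<le>
      real_of_int (2 * int (N i + n) + A (X i) * (B (Y i) div gcd (A (X i)) (B (Y i))))"
      using y[OF that] by (simp only: of_int_le_iff)
    then show "real (y i) \<le> 2 * (N i + n) / B (Y i) + A (X i) / ?g (X i) (Y i)"
      using b d by (intro le) (simp_all add: mult.commute)
  qed
  \<comment> \<open>The division by \<open>A (X i)\<close> cancels against the bound
    \<open>cX\<close>, which leaves \<open>2 * n * card Z\<close> for each cycle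
    \<open>Z\<close>.\<close>
  have 1: "(\<Sum>i\<in>I. card (X i) / A (X i) * (real (N i) + n)) \<le> 2 * n\<^sup>2"
  proof -
    have "(\<Sum>i\<in>I. card (X i) / A (X i) * (real (N i) + n)) \<le>
      (\<Sum>Z\<in>F. card Z / A Z * (2 * real n * real_of_int (A Z)))"
      by (rule grouped_sum_le[OF finF XF, where w = "\<lambda>Z. card Z / A Z"])
        (use cX posF in \<open>auto simp: less_imp_le\<close>)
    also have "\<dots> = 2 * real n * (\<Sum>Z\<in>F. real (card Z))"
      using posF by (auto simp: sum_distrib_left intro!: sum.cong) (metis less_irrefl)
    also have "\<dots> \<le> 2 * real n * real n" using sF by (intro mult_left_mono) auto
    finally show ?thesis by (simp add: power2_eq_square)
  qed
  have 2: "(\<Sum>i\<in>I. card (Y i) / B (Y i) * (real (N i) + n)) \<le> 2 * n\<^sup>2"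
  proof -
    have "(\<Sum>i\<in>I. card (Y i) / B (Y i) * (real (N i) + n)) \<le>
      (\<Sum>Z\<in>G. card Z / B Z * (2 * real n * real_of_int (B Z)))"
      by (rule grouped_sum_le[OF finG YG, where w = "\<lambda>Z. card Z / B Z"])
        (use cY posG in \<open>auto simp: less_imp_le\<close>)
    also have "\<dots> = 2 * real n * (\<Sum>Z\<in>G. real (card Z))"
      using posG by (auto simp: sum_distrib_left intro!: sum.cong) (metis less_irrefl)
    also have "\<dots> \<le> 2 * real n * real n" using sG by (intro mult_left_mono) auto
    finally show ?thesis by (simp add: power2_eq_square)
  qed
  have 3: "(\<Sum>i\<in>I. real (N i)) \<le> n\<^sup>2"
  proof -
    have "(\<Sum>i\<in>I. 1 * real (N i)) \<le> (\<Sum>Z\<in>F. 1 * (real n * real_of_int (A Z)))"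
    proof (rule grouped_sum_le[OF finF XF, where w = "\<lambda>_. 1"])
      fix Z assume "Z \<in> F"
      then have "real_of_int (\<Sum>i | i \<in> I \<and> X i = Z. int (N i)) \<le> real_of_int (int n * A Z)"
        using NF by (simp only: of_int_le_iff)
      then show "(\<Sum>i | i \<in> I \<and> X i = Z. real (N i)) \<le> real n * real_of_int (A Z)" by simp
    qed simp
    also have "\<dots> \<le> (\<Sum>Z\<in>F. real n * real (card Z))"
    proof -
      have "real n * real_of_int (A Z) \<le> real n * real (card Z)" if "Z \<in> F" for Z
        using A_le_card[OF that] by (intro mult_left_mono) linarith+
      then show ?thesis by (simp add: sum_mono)
    qed
    also have "\<dots> = real n * (\<Sum>Z\<in>F. real (card Z))" by (simp add: sum_distrib_left)
    also have "\<dots> \<le> real n * real n" using sF by (intro mult_left_mono) auto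
    finally show ?thesis by (simp add: power2_eq_square)
  qed
  \<comment> \<open>At most \<open>?g Z Z'\<close> jumps lead from \<open>Z\<close> to
    \<open>Z'\<close>, which cancels the denominator. What remains is a sum of
    \<open>card Z * card Z'\<close> over all pairs.\<close>
  have pair: "(\<Sum>i\<in>I. w (X i, Y i) / ?g (X i) (Y i)) \<le> n\<^sup>2"
    if w: "\<And>Z Z'. Z \<in> F \<Longrightarrow> Z' \<in> G \<Longrightarrow> 0 \<le> w (Z, Z') \<and> w (Z, Z') \<le> real (card Z) * card Z'"
    for w :: "'q set \<times> 'q set \<Rightarrow> real"
  proof -
    have "(\<Sum>i\<in>I. w (X i, Y i) / ?g (X i) (Y i) * 1) \<le>
      (\<Sum>z\<in>F \<times> G. w z / ?g (fst z) (snd z) * ?g (fst z) (snd z))"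
      by (rule order_trans[OF _ grouped_sum_le[where \<kappa> = "\<lambda>i. (X i, Y i)"
          and w = "\<lambda>z. w z / ?g (fst z) (snd z)" and u = "\<lambda>_. 1"]])
        (use finF finG X Y cXY w in auto)
    also have "\<dots> \<le> (\<Sum>z\<in>F \<times> G. real (card (fst z)) * card (snd z))"
      using w posF by (intro sum_mono) (fastforce)
    also have "\<dots> = (\<Sum>Z\<in>F. real (card Z)) * (\<Sum>Z\<in>G. real (card Z))"
      by (simp add: sum_product sum.cartesian_product case_prod_beta)
    also have "\<dots> \<le> real n * real n" using sF sG by (intro mult_mono) (auto intro: sum_nonneg)
    finally show ?thesis by (simp add: power2_eq_square)
  qed
  have 4: "(\<Sum>i\<in>I. card (X i) * real_of_int (B (Y i)) / ?g (X i) (Y i)) \<le> n\<^sup>2"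
  proof -
    have "0 \<le> card Z * real_of_int (B Z') \<and> card Z * real_of_int (B Z') \<le> real (card Z) * card Z'"
      if "Z \<in> F" "Z' \<in> G" for Z Z'
      using B_le_card[OF that(2)] posG[OF that(2)] by (auto intro!: mult_left_mono)
    then show ?thesis using pair[of "\<lambda>(Z, Z'). card Z * real_of_int (B Z')"] by simp
  qed
  have 5: "(\<Sum>i\<in>I. card (Y i) * real_of_int (A (X i)) / ?g (X i) (Y i)) \<le> n\<^sup>2"
  proof -
    have "0 \<le> card Z' * real_of_int (A Z) \<and> card Z' * real_of_int (A Z) \<le> real (card Z) * card Z'"
      if "Z \<in> F" "Z' \<in> G" for Z Z'
      using A_le_card[OF that(1)] posF[OF that(1)]
      by (auto simp: mult.commute[of "real (card Z)"] intro!: mult_left_mono)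
    then show ?thesis using pair[of "\<lambda>(Z, Z'). card Z' * real_of_int (A Z)"] by simp
  qed
  have "real (\<Sum>i\<in>I. x i * card (X i) + N i + y i * card (Y i)) =
    (\<Sum>i\<in>I. real (x i) * card (X i) + N i + real (y i) * card (Y i))" by simp
  also have "\<dots> \<le> (\<Sum>i\<in>I. ((N i + n) / A (X i) + B (Y i) / ?g (X i) (Y i)) * card (X i) + N i +
      (2 * (N i + n) / B (Y i) + A (X i) / ?g (X i) (Y i)) * card (Y i))"
    by (intro sum_mono add_mono mult_right_mono xr yr order_refl) auto
  also have "\<dots> = (\<Sum>i\<in>I. card (X i) / A (X i) * (real (N i) + n)) +
      (\<Sum>i\<in>I. card (X i) * real_of_int (B (Y i)) / ?g (X i) (Y i)) + (\<Sum>i\<in>I. real (N i)) +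
      2 * (\<Sum>i\<in>I. card (Y i) / B (Y i) * (real (N i) + n)) +
      (\<Sum>i\<in>I. card (Y i) * real_of_int (A (X i)) / ?g (X i) (Y i))"
    unfolding sum_distrib_left sum.distrib[symmetric]
    by (intro sum.cong refl) (simp add: algebra_simps add_divide_distrib)
  \<comment> \<open>In the order of the five sums: 2 + 1 + 1 + 2 * 2 + 1 = 9.\<close>
  also have "\<dots> \<le> real (9 * n\<^sup>2)" using 1 2 3 4 5 by simp
  finally show ?thesis by (simp only: of_nat_le_iff)
qed

end


section \<open>Runs of the one-counter system\<close>

definition step_rel :: "'q ocs \<Rightarrow> 'q config rel" where
  "step_rel S = {(\<gamma>, \<gamma>'). \<exists>t. step S \<gamma> t \<gamma>'}"

lemma step_rel_iff:
  "((p, c), (q, c')) \<in> step_rel S \<longleftrightarrow>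
    (c > 0 \<and> (p, int c' - int c, q) \<in> tpos S) \<or> (c = 0 \<and> (p, int c', q) \<in> tzero S)"
  by (auto simp: step_rel_def step_def)

text \<open>Relation powers replace explicit paths from here on, since lengths then simply add under
  composition.\<close>

lemma path_iff_relpow:
  "(\<exists>\<pi>. is_path S \<pi> \<alpha> \<beta> \<and> length \<pi> = l) \<longleftrightarrow> (\<alpha>, \<beta>) \<in> step_rel S ^^ l"
proof (induction l arbitrary: \<alpha>)
  case (Suc l)
  have "(\<exists>\<pi>. is_path S \<pi> \<alpha> \<beta> \<and> length \<pi> = Suc l) \<longleftrightarrow>
    (\<exists>t \<gamma>. step S \<alpha> t \<gamma> \<and> (\<exists>\<pi>. is_path S \<pi> \<gamma> \<beta> \<and> length \<pi> = l))"
  proof (intro iffI)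
    assume "\<exists>\<pi>. is_path S \<pi> \<alpha> \<beta> \<and> length \<pi> = Suc l"
    then obtain \<gamma> t \<pi> where "is_path S ((\<gamma>, t) # \<pi>) \<alpha> \<beta>" "length \<pi> = l"
      by (metis length_Suc_conv surj_pair)
    then obtain \<gamma>' where "step S \<alpha> t \<gamma>'" "is_path S \<pi> \<gamma>' \<beta>"
      unfolding is_path.simps by blast
    with \<open>length \<pi> = l\<close> show "\<exists>t \<gamma>. step S \<alpha> t \<gamma> \<and> (\<exists>\<pi>. is_path S \<pi> \<gamma> \<beta> \<and> length \<pi> = l)"
      by blast
  next
    assume "\<exists>t \<gamma>. step S \<alpha> t \<gamma> \<and> (\<exists>\<pi>. is_path S \<pi> \<gamma> \<beta> \<and> length \<pi> = l)"
    then obtain t \<gamma> \<pi> where "step S \<alpha> t \<gamma>" "is_path S \<pi> \<gamma> \<beta>" "length \<pi> = l" by blast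
    then show "\<exists>\<pi>. is_path S \<pi> \<alpha> \<beta> \<and> length \<pi> = Suc l"
      unfolding is_path.simps by (intro exI[of _ "(\<alpha>, t) # \<pi>"] conjI) (simp_all only: is_path.simps list.size, blast+)
  qed
  also have "\<dots> \<longleftrightarrow> (\<exists>\<gamma>. (\<alpha>, \<gamma>) \<in> step_rel S \<and> (\<gamma>, \<beta>) \<in> step_rel S ^^ l)"
    unfolding Suc.IH step_rel_def by blast
  also have "\<dots> \<longleftrightarrow> (\<alpha>, \<beta>) \<in> step_rel S ^^ Suc l"
    by (blast dest: relpow_Suc_D2 intro: relpow_Suc_I2)
  finally show ?case .
qed auto

lemma relpow_trans: "(a, b) \<in> R ^^ l \<Longrightarrow> (b, c) \<in> R ^^ l' \<Longrightarrow> (a, c) \<in> R ^^ (l + l')"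
  by (auto simp: relpow_add)

lemma wf_ocsD:
  assumes "wf_ocs S"
  shows "finite (states S)" "tpos S \<subseteq> states S \<times> {-1,0,1} \<times> states S"
    "tzero S \<subseteq> states S \<times> {0,1} \<times> states S"
  using assms by (auto simp: wf_ocs_def)

text \<open>A step lowers the counter by at most 1, so from \<open>c \<ge> l\<close> it is positive
  before each of the \<open>l\<close> steps and non-zero transitions can fire.\<close>

lemma walk_run:
  assumes "wf_ocs S"
  shows "walk (tpos S) l p e q \<Longrightarrow> l \<le> c \<Longrightarrow> int c' = int c + e \<Longrightarrow>
    ((p, c), (q, c')) \<in> step_rel S ^^ l"
proof (induction l arbitrary: p e c)
  case (Suc l)
  then obtain d r where dr: "(p, d, r) \<in> tpos S" "walk (tpos S) l r (e - d) q" by auto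
  have d: "d \<ge> -1" using wf_ocsD(2)[OF assms] dr(1) by auto
  define c1 where "c1 = nat (int c + d)"
  have c1: "int c1 = int c + d" using d Suc.prems by (simp add: c1_def)
  have "((p, c), (r, c1)) \<in> step_rel S"
    using dr(1) c1 Suc.prems(2) by (auto simp: step_rel_iff)
  moreover have "((r, c1), (q, c')) \<in> step_rel S ^^ l"
    using Suc.IH[OF dr(2), of c1] c1 d Suc.prems by auto
  ultimately show ?case by (rule relpow_Suc_I2)
qed auto

lemma pump_up:
  assumes "wf_ocs S" "walk (tpos S) l p a p" "0 \<le> a" "l \<le> c" "int c' = int c + int x * a"
  shows "((p, c), (p, c')) \<in> step_rel S ^^ (x * l)"
  using assms(5)
proof (induction x arbitrary: c')
  case (Suc x)
  define c1 where "c1 = c + x * nat a"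
  have c1: "int c1 = int c + int x * a" using assms(3) by (simp add: c1_def)
  have "((p, c), (p, c1)) \<in> step_rel S ^^ (x * l)" by (rule Suc.IH[OF c1])
  moreover have "((p, c1), (p, c')) \<in> step_rel S ^^ l"
    by (rule walk_run[OF assms(1,2)]) (use assms(4) Suc.prems c1 in \<open>auto simp: c1_def algebra_simps\<close>)
  ultimately show ?case using relpow_trans by (fastforce simp: add.commute)
qed simp

lemma pump_down:
  assumes "wf_ocs S" "walk (tpos S) l p (- b) p" "0 \<le> b" "l \<le> c" "int c' = int c + int y * b"
  shows "((p, c'), (p, c)) \<in> step_rel S ^^ (y * l)"
  using assms(5)
proof (induction y arbitrary: c')
  case (Suc y)
  define c1 where "c1 = c + y * nat b"
  have c1: "int c1 = int c + int y * b" using assms(3) by (simp add: c1_def)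
  have "int c' = int c1 + b" using Suc.prems c1 by (simp add: algebra_simps)
  moreover from this have "l \<le> c'" using assms(3,4) c1_def by linarith
  ultimately have "((p, c'), (p, c1)) \<in> step_rel S ^^ l"
    by (intro walk_run[OF assms(1,2)]) auto
  from relpow_trans[OF this Suc.IH[OF c1]] show ?case by simp
qed simp

text \<open>Pump the first cycle \<open>x\<close> times, follow the middle walk, pump the second
  cycle \<open>y\<close> times. A climb of at least \<open>N + n\<close> makes room for the
  \<open>N\<close> middle steps and ends them at or above \<open>k\<close>, at a distance from
  \<open>k\<close> that the choice of \<open>x\<close> makes a multiple of \<open>b\<close>.\<close>

lemma realize_jump:
  assumes wf: "wf_ocs S"
    and up: "walk (tpos S) lX s a s" "0 < a" and down: "walk (tpos S) lY t (- b) t" "0 < b"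
    and mid: "walk (tpos S) N s f t" "[f = int k - int h] (mod gcd a b)"
    and bounds: "lX \<le> n" "lY \<le> n" "n \<le> h" "n \<le> k" "\<bar>int h - int k\<bar> \<le> int n"
  shows "\<exists>x y. ((s, h), (t, k)) \<in> step_rel S ^^ (x * lX + N + y * lY) \<and>
    int x * a \<le> int (N + n) + a * (b div gcd a b) \<and>
    int y * b \<le> 2 * int (N + n) + a * (b div gcd a b)"
proof -
  \<comment> \<open>The total effect that the two cycles have to supply:
    \<open>x * a - y * b = D\<close>.\<close>
  define D where "D = int k - int h - f"
  define T where "T = a * (b div gcd a b)"
  have "gcd a b dvd D" using mid(2) unfolding D_def cong_iff_dvd_diff
    by (simp add: dvd_diff_commute)
  then obtain x where x: "0 \<le> x" "b dvd x * a - D" "int (N + n) \<le> x * a"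
    "x * a \<le> int (N + n) + T"
    using pump_count[OF up(2) down(2), of D "int (N + n)"] unfolding T_def by auto
  have f: "\<bar>f\<bar> \<le> int N" by (rule walk_abs_le[OF wf_ocsD(2)[OF wf] mid(1)])
  obtain y where y: "x * a - D = b * y" using x(2) by auto
  \<comment> \<open>The upper bound on \<open>D\<close> yields \<open>0 \<le> y\<close>; the lower
    one is the source of the factor 2 in the bound on \<open>y\<close>.\<close>
  have D: "- int (N + n) \<le> D" "D \<le> int (N + n)" using f bounds(5) unfolding D_def by auto
  have D': "0 \<le> x * a - D" "x * a - D \<le> 2 * int (N + n) + T"
    using diff_mono[OF x(3) D(2)] diff_mono[OF x(4) D(1)] by simp_all
  then have y': "0 \<le> y" "y * b \<le> 2 * int (N + n) + T"
    using y down(2) unfolding y by (auto simp: zero_le_mult_iff mult.commute)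
  define c where "c = nat (int h + x * a)"
  define d where "d = nat (int k + y * b)"
  have c: "int c = int h + int (nat x) * a" using x(1) up(2) by (simp add: c_def)
  have d: "int d = int k + int (nat y) * b" using y'(1) down(2) by (simp add: d_def)
  have "((s, h), (s, c)) \<in> step_rel S ^^ (nat x * lX)"
    by (rule pump_up[OF wf up(1)]) (use up bounds c in auto)
  moreover have "((s, c), (t, d)) \<in> step_rel S ^^ N"
  proof (rule walk_run[OF wf mid(1)])
    show "N \<le> c" using c x(1,3) by (simp add: nat_le_iff)
    show "int d = int c + f" using c d x(1) y'(1) y by (simp add: D_def algebra_simps)
  qed
  moreover have "((t, d), (t, k)) \<in> step_rel S ^^ (nat y * lY)"
    by (rule pump_down[OF wf down(1)]) (use down bounds d in auto)
  ultimately have "((s, h), (t, k)) \<in> step_rel S ^^ (nat x * lX + N + nat y * lY)"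
    by (intro relpow_trans)
  moreover have "int (nat x) * a \<le> int (N + n) + T" "int (nat y) * b \<le> 2 * int (N + n) + T"
    using x(1,4) y' by simp_all
  ultimately show ?thesis unfolding T_def by blast
qed

section \<open>Cutting a run into low steps and jumps\<close>

lemma relpow_segment:
  assumes "\<And>x. i \<le> x \<Longrightarrow> x < j \<Longrightarrow> (f x, f (Suc x)) \<in> R" "i \<le> j"
  shows "(f i, f j) \<in> R ^^ (j - i)"
  using assms(2,1)
proof (induction j rule: dec_induct)
  case (step j)
  then have "(f i, f (Suc j)) \<in> R ^^ Suc (j - i)" by auto
  then show ?case using step by (simp add: Suc_diff_le)
qed simp

lemma shortest_chain:
  assumes "(a, b) \<in> R\<^sup>*"
  shows "\<exists>m f. f 0 = a \<and> f m = b \<and> (\<forall>i<m. (f i, f (Suc i)) \<in> R) \<and> inj_on f {..m} \<and>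
    (\<forall>i j. i + 1 < j \<longrightarrow> j \<le> m \<longrightarrow> (f i, f j) \<notin> R)"
proof -
  define m where "m = (LEAST m. (a, b) \<in> R ^^ m)"
  have "\<exists>m. (a, b) \<in> R ^^ m" using assms by (simp add: rtrancl_power)
  then have "(a, b) \<in> R ^^ m" unfolding m_def by (rule LeastI_ex)
  then obtain f where f: "f 0 = a" "f m = b" "\<forall>i<m. (f i, f (Suc i)) \<in> R"
    by (auto simp: relpow_fun_conv)
  have least: "(a, b) \<notin> R ^^ k" if "k < m" for k using that not_less_Least unfolding m_def by blast
  have seg: "(f i, f j) \<in> R ^^ (j - i)" if "i \<le> j" "j \<le> m" for i j
    by (rule relpow_segment) (use f that in auto)
  have cut: "(f i, f j) \<notin> R ^^ k" if "i + k < j" "j \<le> m" for i j k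
  proof
    assume "(f i, f j) \<in> R ^^ k"
    then have "(a, b) \<in> R ^^ (i + k + (m - j))"
      using seg[of 0 i] seg[of j m] f that by (intro relpow_trans) auto
    then show False using least that by simp
  qed
  have "f i \<noteq> f j" if "i < j" "j \<le> m" for i j using cut[of i 0 j] that by auto
  then have "inj_on f {..m}" by (metis atMost_iff inj_onI nat_neq_iff)
  moreover have "(f i, f j) \<notin> R" if "i + 1 < j" "j \<le> m" for i j
    using cut[of i 1 j] that by simp
  ultimately show ?thesis using f by blast
qed

lemma last_index:
  fixes a k :: nat
  assumes "P a" "a \<le> k"
  shows "\<exists>i. a \<le> i \<and> i \<le> k \<and> P i \<and> (\<forall>j. i < j \<and> j \<le> k \<longrightarrow> \<not> P j)"
proof -
  let ?i = "GREATEST i. a \<le> i \<and> i \<le> k \<and> P i"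
  have "a \<le> ?i \<and> ?i \<le> k \<and> P ?i"
    by (rule GreatestI_nat[of _ a k]) (use assms in auto)
  moreover have "j \<le> ?i" if "a \<le> j" "j \<le> k" "P j" for j
    by (rule Greatest_le_nat[of _ j k]) (use that in auto)
  ultimately show ?thesis by (meson le_trans less_imp_le not_le)
qed

lemma first_index:
  fixes b k :: nat
  assumes "P b" "k \<le> b"
  shows "\<exists>i. k \<le> i \<and> i \<le> b \<and> P i \<and> (\<forall>j. k \<le> j \<and> j < i \<longrightarrow> \<not> P j)"
proof -
  let ?i = "LEAST i. k \<le> i \<and> P i"
  have "k \<le> ?i \<and> P ?i" by (rule LeastI[of _ b]) (use assms in simp)
  moreover have "?i \<le> b" by (rule Least_le) (use assms in simp)
  moreover have "\<not> P j" if "k \<le> j" "j < ?i" for j using not_less_Least[OF that(2)] that(1) by simp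
  ultimately show ?thesis by blast
qed

text \<open>Otherwise the segment is a walk on edges that start outside \<open>D\<close>, and
  \<open>walk_bound\<close> keeps its gain below \<open>card Q\<close>.\<close>

lemma climb_hits:
  assumes "finite Q" "E \<subseteq> Q \<times> {-1,0,1} \<times> Q"
    and no_pos: "\<And>l p a. walk {t \<in> E. fst t \<notin> D} l p a p \<Longrightarrow> a \<le> 0"
    and tr: "\<And>x. i \<le> x \<Longrightarrow> x < j \<Longrightarrow> (v x, c (Suc x) - c x, v (Suc x)) \<in> E"
    and "i \<le> j" "v j \<in> Q" "int (card Q) \<le> c j - c i"
  shows "\<exists>x. i \<le> x \<and> x < j \<and> v x \<in> D"
proof (rule ccontr)
  assume "\<not> ?thesis"
  have "v (i + x) \<notin> D" if "x < j - i" for x 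
  proof -
    have "i \<le> i + x" "i + x < j" using that by auto
    then show ?thesis using \<open>\<not> (\<exists>x. i \<le> x \<and> x < j \<and> v x \<in> D)\<close> by blast
  qed
  moreover have "(v (i + x), c (Suc (i + x)) - c (i + x), v (Suc (i + x))) \<in> E" if "x < j - i" for x
    using tr[of "i + x"] that by simp
  ultimately have "trace {t \<in> E. fst t \<notin> D} (j - i) (\<lambda>x. v (i + x)) (\<lambda>x. c (i + x))"
    by (simp add: trace_def)
  from trace_walk[OF this, of 0 "j - i"] assms(5)
  have w: "walk {t \<in> E. fst t \<notin> D} (j - i) (v i) (c j - c i) (v j)" by simp
  have sub: "{t \<in> E. fst t \<notin> D} \<subseteq> Q \<times> {-1,0,1} \<times> Q" using assms(2) by blast
  have "c j - c i < int (card Q)" by (rule walk_bound[OF assms(1) sub no_pos w assms(6)])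
  then show False using assms(7) by linarith
qed

text \<open>Only the endpoints of a jump are confined to the band. The walk behind it is arbitrary,
  so that composing it with arcs of cycles or with other walks again gives a jump.\<close>

definition low_rel :: "'q ocs \<Rightarrow> 'q set set \<Rightarrow> 'q set set \<Rightarrow> ('q set \<Rightarrow> int) \<Rightarrow> ('q set \<Rightarrow> int) \<Rightarrow>
    nat \<Rightarrow> nat \<Rightarrow> 'q config rel" where
  "low_rel S F G A B H H' = {((p, c), (q, d)). p \<in> states S \<and> q \<in> states S \<and> c \<le> H' \<and> d \<le> H' \<and>
    (((p, c), (q, d)) \<in> step_rel S \<or>
     (H \<le> c \<and> H \<le> d \<and> (\<exists>X\<in>F. \<exists>Y\<in>G. p \<in> X \<and> q \<in> Y \<and>
       (\<exists>l e. walk (tpos S) l p e q \<and> [e = int d - int c] (mod gcd (A X) (B Y))))))}"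

lemma step_rel_bounds:
  assumes "wf_ocs S" "(\<gamma>, \<gamma>') \<in> step_rel S"
  shows "fst \<gamma> \<in> states S" "fst \<gamma>' \<in> states S" "snd \<gamma>' \<le> Suc (snd \<gamma>)" "snd \<gamma> \<le> Suc (snd \<gamma>')"
    "0 < snd \<gamma> \<Longrightarrow> (fst \<gamma>, int (snd \<gamma>') - int (snd \<gamma>), fst \<gamma>') \<in> tpos S"
proof -
  obtain p c q d where eq: "\<gamma> = (p, c)" "\<gamma>' = (q, d)" by (cases \<gamma>, cases \<gamma>')
  have *: "(c > 0 \<and> (p, int d - int c, q) \<in> tpos S) \<or> (c = 0 \<and> (p, int d, q) \<in> tzero S)"
    using assms(2) unfolding eq step_rel_iff .
  then have "p \<in> states S \<and> q \<in> states S \<and> int d - int c \<in> {-1,0,1}"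
    using wf_ocsD(2,3)[OF assms(1)] by auto
  then show "fst \<gamma> \<in> states S" "fst \<gamma>' \<in> states S" "snd \<gamma>' \<le> Suc (snd \<gamma>)" "snd \<gamma> \<le> Suc (snd \<gamma>')"
    unfolding eq by auto
  show "0 < snd \<gamma> \<Longrightarrow> (fst \<gamma>, int (snd \<gamma>') - int (snd \<gamma>), fst \<gamma>') \<in> tpos S"
    using * unfolding eq by auto
qed

text \<open>Strong induction on the length of the run: one excursion above \<open>H'\<close> is cut
  out. Its climb through the band supplies the source of a jump, its descent the target, and the
  runs before and after the excursion are shorter.\<close>

lemma low_chain:
  assumes wf: "wf_ocs S" and H: "0 < H" "H' = H + card (states S)"
    and F: "\<And>l p a. walk {t \<in> tpos S. fst t \<notin> \<Union>F} l p a p \<Longrightarrow> a \<le> 0"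
    and G: "\<And>l p a. walk {t \<in> neg (tpos S). fst t \<notin> \<Union>G} l p a p \<Longrightarrow> a \<le> 0"
  shows "\<forall>i<m. (f i, f (Suc i)) \<in> step_rel S \<Longrightarrow> snd (f 0) \<le> H \<Longrightarrow> snd (f m) \<le> H \<Longrightarrow>
    fst (f 0) \<in> states S \<Longrightarrow> (f 0, f m) \<in> (low_rel S F G A B H H')\<^sup>*"
proof (induction m arbitrary: f rule: less_induct)
  case (less m)
  let ?R = "low_rel S F G A B H H'"
  note b = step_rel_bounds[OF wf]
  have st: "(f i, f (Suc i)) \<in> step_rel S" if "i < m" for i using less.prems(1) that by blast
  have Q: "fst (f i) \<in> states S" if "i \<le> m" for i
    using that less.prems(4) b(2)[OF st] by (cases i) auto
  have low: "(f i, f j) \<in> ?R\<^sup>*" if "i \<le> j" "j \<le> m" "\<And>x. i \<le> x \<Longrightarrow> x \<le> j \<Longrightarrow> snd (f x) \<le> H'" for i j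
  proof -
    have "(f x, f (Suc x)) \<in> ?R" if "i \<le> x" "x < j" for x
      using that \<open>j \<le> m\<close> st[of x] b(1,2)[OF st[of x]]
        \<open>\<And>x. i \<le> x \<Longrightarrow> x \<le> j \<Longrightarrow> snd (f x) \<le> H'\<close>[of x]
        \<open>\<And>x. i \<le> x \<Longrightarrow> x \<le> j \<Longrightarrow> snd (f x) \<le> H'\<close>[of "Suc x"]
      by (auto simp: low_rel_def case_prod_beta)
    from relpow_segment[of i j f, OF this] that(1) show ?thesis by (auto intro: relpow_imp_rtrancl)
  qed
  show ?case
  proof (cases "\<forall>i\<le>m. snd (f i) \<le> H'")
    case True
    then show ?thesis using low[of 0 m] by auto
  next
    case False
    then obtain k where k: "k \<le> m" "H' < snd (f k)" by auto
    \<comment> \<open>Around the peak \<open>k\<close>, \<open>i0\<close> and \<open>j0\<close> are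
      the nearest times at level at most \<open>H\<close>. Between them, \<open>i1\<close> is the
      first and \<open>j1\<close> the last time at level at least \<open>H'\<close>.\<close>
    obtain i0 where i0: "i0 \<le> k" "snd (f i0) \<le> H" "\<And>j. i0 < j \<Longrightarrow> j \<le> k \<Longrightarrow> H < snd (f j)"
      using last_index[of "\<lambda>i. snd (f i) \<le> H" 0 k] less.prems by (auto simp: not_le)
    obtain j0 where j0: "k \<le> j0" "j0 \<le> m" "snd (f j0) \<le> H" "\<And>j. k \<le> j \<Longrightarrow> j < j0 \<Longrightarrow> H < snd (f j)"
      using first_index[of "\<lambda>i. snd (f i) \<le> H" m k] less.prems k by (auto simp: not_le)
    obtain i1 where i1: "i0 \<le> i1" "i1 \<le> k" "H' \<le> snd (f i1)"
      "\<And>j. i0 \<le> j \<Longrightarrow> j < i1 \<Longrightarrow> snd (f j) < H'"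
      using first_index[of "\<lambda>i. H' \<le> snd (f i)" k i0] k i0 by (auto simp: not_le)
    obtain j1 where j1: "k \<le> j1" "j1 \<le> j0" "H' \<le> snd (f j1)"
      "\<And>j. j1 < j \<Longrightarrow> j \<le> j0 \<Longrightarrow> snd (f j) < H'"
      using last_index[of "\<lambda>i. H' \<le> snd (f i)" k j0] k j0 by (auto simp: not_le)
    have "i0 \<noteq> k" "j0 \<noteq> k" using i0 j0 k H by auto
    then have lt: "i0 < k" "k < j0" using i0 j0 by auto
    \<comment> \<open>Rests on the state set being nonempty; otherwise \<open>H'\<close> would equal
      \<open>H\<close>.\<close>
    have "j0 \<noteq> j1"
    proof
      assume "j0 = j1"
      show False using j1(3) j0(3) H \<open>j0 = j1\<close> k
        by (cases "card (states S) = 0") (use Q[OF k(1)] wf_ocsD(1)[OF wf] in auto)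
    qed
    then have j1j0: "j1 < j0" using j1 by simp
    have i0H: "snd (f i0) = H"
      using i0(2) i0(3)[of "Suc i0"] b(3)[OF st[of i0]] lt k by auto
    have j0H: "snd (f j0) = H"
    proof -
      have "Suc (j0 - 1) = j0" "k \<le> j0 - 1" "j0 - 1 < j0" "j0 - 1 < m" using lt j0(2) by auto
      then show ?thesis using j0(3) j0(4)[of "j0 - 1"] b(4)[OF st[of "j0 - 1"]] by simp
    qed
    have high: "H \<le> snd (f x)" if "i0 \<le> x" "x \<le> j0" for x
      using i0(3)[of x] j0(4)[of x] i0H j0H that by (cases "x \<le> k"; cases "x = i0"; cases "x = j0") auto
    \<comment> \<open>The counter stays at or above \<open>H > 0\<close> during the excursion, so no
      zero test occurs.\<close>
    have edge: "(fst (f x), int (snd (f (Suc x))) - int (snd (f x)), fst (f (Suc x))) \<in> tpos S"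
      if "i0 \<le> x" "x < j0" for x
      using b(5)[OF st[of x]] high[of x] H that j0(2) by auto
    have "\<exists>x. i0 \<le> x \<and> x < i1 \<and> fst (f x) \<in> \<Union>F"
      by (rule climb_hits[OF wf_ocsD(1,2)[OF wf] F, where c = "\<lambda>x. int (snd (f x))"])
        (use edge i1 i0H H j1 lt k Q in auto)
    then obtain i X where i: "i0 \<le> i" "i < i1" "X \<in> F" "fst (f i) \<in> X" by auto
    have negE: "neg (tpos S) \<subseteq> states S \<times> {-1,0,1} \<times> states S"
      using wf_ocsD(2)[OF wf] by (force simp: neg_def)
    \<comment> \<open>The descent is a climb of the negated counter in
      \<open>neg (tpos S)\<close>.\<close>
    have "\<exists>x. j1 \<le> x \<and> x < j0 \<and> fst (f x) \<in> \<Union>G"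
      by (rule climb_hits[OF wf_ocsD(1)[OF wf] negE G, where c = "\<lambda>x. - int (snd (f x))"])
        (use edge j1 j0H H lt i0 j0 Q in \<open>auto simp: neg_iff\<close>)
    then obtain j Y where j: "j1 \<le> j" "j < j0" "Y \<in> G" "fst (f j) \<in> Y" by auto
    have j1H: "snd (f j1) \<le> H'"
      using j1(4)[of "Suc j1"] b(4)[OF st[of j1]] j1j0 j0(2) by auto
    have jH: "snd (f x) \<le> H'" if "j1 \<le> x" "x \<le> j0" for x
      using j1(4)[of x] j1H that by (cases "x = j1") auto
    have ij: "i \<le> j" using i j i1 j1 by simp
    have "trace (tpos S) (j - i) (\<lambda>x. fst (f (i + x))) (\<lambda>x. int (snd (f (i + x))))"
      using edge i j by (auto simp: trace_def)
    from trace_walk[OF this, of 0 "j - i"] ij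
    have "walk (tpos S) (j - i) (fst (f i)) (int (snd (f j)) - int (snd (f i))) (fst (f j))" by simp
    then have "\<exists>l e. walk (tpos S) l (fst (f i)) e (fst (f j)) \<and>
      [e = int (snd (f j)) - int (snd (f i))] (mod gcd (A X) (B Y))" using cong_refl by blast
    moreover have "H \<le> snd (f i)" "H \<le> snd (f j)" "snd (f i) \<le> H'" "snd (f j) \<le> H'"
      "fst (f i) \<in> states S" "fst (f j) \<in> states S"
      using high[of i] high[of j] i1(4)[of i] jH[of j] Q i j ij j0(2) by auto
    ultimately have "(f i, f j) \<in> ?R"
      using i(3,4) j(3,4) unfolding low_rel_def case_prod_beta
      by (simp only: mem_Collect_eq fst_conv snd_conv prod.collapse) blast
    moreover have "(f 0, f i0) \<in> ?R\<^sup>*"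
      by (rule less.IH) (use lt k less.prems i0 in auto)
    moreover have "(f i0, f i) \<in> ?R\<^sup>*"
      by (rule low) (use i i1 k in \<open>auto intro: less_imp_le\<close>)
    moreover have "(f j, f j0) \<in> ?R\<^sup>*"
      by (rule low) (use j j0 jH in auto)
    moreover have "(f (j0 + 0), f (j0 + (m - j0))) \<in> ?R\<^sup>*"
      by (rule less.IH) (use lt less.prems j0 Q in auto)
    ultimately show ?thesis using j0(2) by (simp; meson rtrancl_into_rtrancl rtrancl_trans)
  qed
qed


section \<open>Assembling the bound\<close>

lemma relpow_sum:
  assumes "\<And>i. i < m \<Longrightarrow> (f i, f (Suc i)) \<in> R ^^ cost i"
  shows "(f 0, f m) \<in> R ^^ (\<Sum>i<m. cost i)"
  using assms by (induction m) (auto intro: relpow_trans)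

theorem theorem2:
  fixes S :: "'q ocs" and n :: nat and p\<^sub>\<alpha> p\<^sub>\<beta> :: 'q and c\<^sub>\<alpha> c\<^sub>\<beta> :: nat
  assumes "wf_ocs S"
    and "card (states S) = n"
    and "p\<^sub>\<alpha> \<in> states S" and "p\<^sub>\<beta> \<in> states S"
    and "reachable S (p\<^sub>\<alpha>, c\<^sub>\<alpha>) (p\<^sub>\<beta>, c\<^sub>\<beta>)"
  shows "\<exists>\<pi>. is_path S \<pi> (p\<^sub>\<alpha>, c\<^sub>\<alpha>) (p\<^sub>\<beta>, c\<^sub>\<beta>)
             \<and> length \<pi> \<le> 14 * n^2 + n * max c\<^sub>\<alpha> c\<^sub>\<beta>"
proof -
  let ?Q = "states S" and ?E = "tpos S"
  let ?\<alpha> = "(p\<^sub>\<alpha>, c\<^sub>\<alpha>)" and ?\<beta> = "(p\<^sub>\<beta>, c\<^sub>\<beta>)"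
  note wf = assms(1) and finQ = wf_ocsD(1)[OF assms(1)] and EQ = wf_ocsD(2)[OF assms(1)]
  have n: "0 < n" using finQ assms(2,3) by (auto simp: card_gt_0_iff)
  have negE: "neg ?E \<subseteq> ?Q \<times> {-1,0,1} \<times> ?Q" using EQ by (force simp: neg_def)
  obtain F A P where F: "F \<subseteq> Pow ?Q" "disjoint F" "\<forall>X\<in>F. cyc ?E X (A X) (P X)"
    and F0: "\<forall>l p a. walk {t \<in> ?E. fst t \<notin> \<Union>F} l p a p \<longrightarrow> a \<le> 0"
    using hitting_family[OF finQ EQ] by (elim exE conjE) (rule that)
  obtain G B R where G: "G \<subseteq> Pow ?Q" "disjoint G" "\<forall>Y\<in>G. cyc (neg ?E) Y (B Y) (R Y)"
    and G0: "\<forall>l p a. walk {t \<in> neg ?E. fst t \<notin> \<Union>G} l p a p \<longrightarrow> a \<le> 0"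
    using hitting_family[OF finQ negE] by (elim exE conjE) (rule that)
  \<comment> \<open>The maximum keeps both endpoints below the band; the summand \<open>n\<close>
    lets a cycle, of at most \<open>n\<close> states, be run from any level of the band.\<close>
  define H where "H = max c\<^sub>\<alpha> c\<^sub>\<beta> + n"
  let ?R = "low_rel S F G A B H (H + n)"
  obtain l where "(?\<alpha>, ?\<beta>) \<in> step_rel S ^^ l"
    using assms(5) path_iff_relpow[of S ?\<alpha> ?\<beta>] unfolding reachable_def by blast
  then obtain r where r: "r 0 = ?\<alpha>" "r l = ?\<beta>" "\<forall>i<l. (r i, r (Suc i)) \<in> step_rel S"
    by (auto simp: relpow_fun_conv)
  have "(r 0, r l) \<in> ?R\<^sup>*"
    by (rule low_chain[OF wf]) (use r n F0 G0 assms(2,3) in \<open>auto simp: H_def\<close>)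
  then have chain: "(?\<alpha>, ?\<beta>) \<in> ?R\<^sup>*" by (simp only: r)
  obtain m f where f_conj: "f 0 = ?\<alpha> \<and> f m = ?\<beta> \<and> (\<forall>i<m. (f i, f (Suc i)) \<in> ?R) \<and> inj_on f {..m} \<and>
    (\<forall>i j. i + 1 < j \<longrightarrow> j \<le> m \<longrightarrow> (f i, f j) \<notin> ?R)"
    using shortest_chain[OF chain] by (elim exE) (rule that)
  then have f: "f 0 = ?\<alpha>" "f m = ?\<beta>" "\<And>i. i < m \<Longrightarrow> (f i, f (Suc i)) \<in> ?R"
    "inj_on f {..m}" "\<And>i j. i + 1 < j \<Longrightarrow> j \<le> m \<Longrightarrow> (f i, f j) \<notin> ?R"
    by blast+
  \<comment> \<open>The \<open>m + 1\<close> configurations of the chain are distinct elements of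
    \<open>?Q \<times> {..H + n}\<close>.\<close>
  have m: "m < n * (H + n + 1)"
  proof -
    have "f i \<in> ?Q \<times> {..H + n}" if "i \<le> m" for i
    proof (cases "i = m")
      case True
      then show ?thesis using f(2) assms(4) by (auto simp: H_def)
    next
      case False
      then show ?thesis using f(3)[of i] that by (cases "f i") (auto simp: low_rel_def)
    qed
    then have "f ` {..m} \<subseteq> ?Q \<times> {..H + n}" by (intro image_subsetI) simp
    then have "card (f ` {..m}) \<le> card (?Q \<times> {..H + n})"
      using finQ by (intro card_mono) simp_all
    then show ?thesis using card_image[OF f(4)] assms(2) by (simp add: card_cartesian_product)
  qed
  \<comment> \<open>A pair that is both a step and a jump is charged as a step, at cost 1.\<close>
  define I where "I = {i. i < m \<and> (f i, f (Suc i)) \<notin> step_rel S}"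
  define s t h k where "s i = fst (f i)" and "t i = fst (f (Suc i))"
    and "h i = snd (f i)" and "k i = snd (f (Suc i))" for i
  define J where "J i X Y \<longleftrightarrow> X \<in> F \<and> Y \<in> G \<and> s i \<in> X \<and> t i \<in> Y \<and>
    (\<exists>l e. walk ?E l (s i) e (t i) \<and> [e = int (k i) - int (h i)] (mod gcd (A X) (B Y)))" for i X Y
  have "H \<le> h i \<and> H \<le> k i \<and> h i \<le> H + n \<and> k i \<le> H + n \<and> (\<exists>X Y. J i X Y)" if "i \<in> I" for i
    using that f(3)[of i] unfolding I_def low_rel_def case_prod_beta s_def t_def h_def k_def J_def
    by (simp only: mem_Collect_eq fst_conv snd_conv prod.collapse) blast
  then have range: "H \<le> h i \<and> H \<le> k i \<and> h i \<le> H + n \<and> k i \<le> H + n"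
    and ex: "\<exists>X Y. J i X Y" if "i \<in> I" for i
    using that by blast+
  obtain X Y where "\<And>i. i \<in> I \<Longrightarrow> J i (X i) (Y i)"
    using ex by metis
  note XY = this[unfolded J_def]
  interpret jump_system ?Q ?E F G A B P R I X Y s t "\<lambda>i. int (h i)" "\<lambda>i. int (k i)"
  proof
    show "finite I" by (simp add: I_def)
    fix i j l e
    assume ij: "i \<in> I" "j \<in> I" "i < j" and w: "walk ?E l (s i) e (t j)"
    show "\<not> [e = int (k j) - int (h i)] (mod gcd (A (X i)) (B (Y j)))"
    proof
      assume "[e = int (k j) - int (h i)] (mod gcd (A (X i)) (B (Y j)))"
      then have "\<exists>l e. walk ?E l (s i) e (t j) \<and>
        [e = int (k j) - int (h i)] (mod gcd (A (X i)) (B (Y j)))" using w by blast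
      moreover have "X i \<in> F" "Y j \<in> G" "s i \<in> X i" "t j \<in> Y j" using XY ij by auto
      moreover have "s i \<in> ?Q" "t j \<in> ?Q" using calculation F(1) G(1) by auto
      moreover have "H \<le> h i" "H \<le> k j" "h i \<le> H + n" "k j \<le> H + n" using range ij by auto
      ultimately have "((s i, h i), (t j, k j)) \<in> ?R"
        unfolding low_rel_def by (simp only: mem_Collect_eq case_prod_conv) blast
      \<comment> \<open>From \<open>i < j\<close> the indices \<open>i\<close> and
        \<open>Suc j\<close> are at least 2 apart, as a chord requires.\<close>
      moreover have "(f i, f (Suc j)) \<notin> ?R" using f(5)[of i "Suc j"] ij by (auto simp: I_def)
      ultimately show False by (simp add: s_def t_def h_def k_def)
    qed
  qed (use finQ EQ F G XY in auto)
  obtain N where N_conj: "(\<forall>i\<in>I. \<exists>e. walk ?E (N i) (s i) e (t i) \<and>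
      [e = int (k i) - int (h i)] (mod gcd (A (X i)) (B (Y i)))) \<and>
    (\<forall>Z\<in>F. (\<Sum>i | i \<in> I \<and> X i = Z. int (N i)) \<le> int (card ?Q) * A Z) \<and>
    (\<forall>Z\<in>G. (\<Sum>i | i \<in> I \<and> Y i = Z. int (N i)) \<le> int (card ?Q) * B Z)"
    using short_walks by (elim exE) (rule that)
  then have N: "\<And>i. i \<in> I \<Longrightarrow> \<exists>e. walk ?E (N i) (s i) e (t i) \<and>
      [e = int (k i) - int (h i)] (mod gcd (A (X i)) (B (Y i)))"
    and NF: "\<And>Z. Z \<in> F \<Longrightarrow> (\<Sum>i | i \<in> I \<and> X i = Z. int (N i)) \<le> int (card ?Q) * A Z"
    and NG: "\<And>Z. Z \<in> G \<Longrightarrow> (\<Sum>i | i \<in> I \<and> Y i = Z. int (N i)) \<le> int (card ?Q) * B Z"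
    by blast+
  define K where "K i x y \<longleftrightarrow>
    ((s i, h i), (t i, k i)) \<in> step_rel S ^^ (x * card (X i) + N i + y * card (Y i)) \<and>
    int x * A (X i) \<le> int (N i + n) + A (X i) * (B (Y i) div gcd (A (X i)) (B (Y i))) \<and>
    int y * B (Y i) \<le> 2 * int (N i + n) + A (X i) * (B (Y i) div gcd (A (X i)) (B (Y i)))" for i x y
  have "\<exists>x y. K i x y" if i: "i \<in> I" for i
  proof -
    have XF: "X i \<in> F" "s i \<in> X i" and YG: "Y i \<in> G" "t i \<in> Y i" using XY[OF i] by auto
    obtain e where e: "walk ?E (N i) (s i) e (t i)"
      "[e = int (k i) - int (h i)] (mod gcd (A (X i)) (B (Y i)))" using N[OF i] by blast
    have "walk ?E (card (X i)) (s i) (A (X i)) (s i)" "0 < A (X i)"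
      using cycF[OF XF(1)] XF(2) by (auto simp: cyc_def)
    moreover have "walk (neg ?E) (card (Y i)) (t i) (B (Y i)) (t i)" "0 < B (Y i)"
      using cycG[OF YG(1)] YG(2) by (auto simp: cyc_def)
    then have "walk ?E (card (Y i)) (t i) (- B (Y i)) (t i)" "0 < B (Y i)"
      by (simp_all add: walk_neg)
    moreover have "card (X i) \<le> n" "card (Y i) \<le> n"
      using XF YG F(1) G(1) finQ assms(2) by (auto intro!: card_mono)
    moreover have "n \<le> h i" "n \<le> k i" "\<bar>int (h i) - int (k i)\<bar> \<le> int n"
      using range[OF i] by (auto simp: H_def)
    ultimately show ?thesis unfolding K_def by (intro realize_jump[OF wf _ _ _ _ e])
  qed
  then obtain x y where "\<And>i. i \<in> I \<Longrightarrow> K i (x i) (y i)" by metis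
  then have
    run: "\<And>i. i \<in> I \<Longrightarrow>
      ((s i, h i), (t i, k i)) \<in> step_rel S ^^ (x i * card (X i) + N i + y i * card (Y i))"
    and x: "\<And>i. i \<in> I \<Longrightarrow> int (x i) * A (X i) \<le>
      int (N i + n) + A (X i) * (B (Y i) div gcd (A (X i)) (B (Y i)))"
    and y: "\<And>i. i \<in> I \<Longrightarrow> int (y i) * B (Y i) \<le>
      2 * int (N i + n) + A (X i) * (B (Y i) div gcd (A (X i)) (B (Y i)))"
    unfolding K_def by blast+
  define c where "c i = x i * card (X i) + N i + y i * card (Y i)" for i
  have cost: "(\<Sum>i\<in>I. c i) \<le> 9 * n\<^sup>2"
    unfolding c_def assms(2)[symmetric]
    by (rule cost_bound[OF NF NG]) (use x y assms(2) in simp_all)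
  have "(f 0, f m) \<in> step_rel S ^^ (\<Sum>i<m. if i \<in> I then c i else 1)"
  proof (rule relpow_sum)
    fix i assume "i < m"
    then show "(f i, f (Suc i)) \<in> step_rel S ^^ (if i \<in> I then c i else 1)"
      using run[of i] by (cases "i \<in> I") (auto simp: c_def s_def t_def h_def k_def I_def)
  qed
  then obtain \<pi> where \<pi>: "is_path S \<pi> ?\<alpha> ?\<beta>" "length \<pi> = (\<Sum>i<m. if i \<in> I then c i else 1)"
    using path_iff_relpow[of S ?\<alpha> ?\<beta>] unfolding f(1,2) by blast
  have "(\<Sum>i<m. if i \<in> I then c i else 1) \<le> (\<Sum>i<m. 1 + (if i \<in> I then c i else 0))"
    by (intro sum_mono) auto
  also have "\<dots> = m + (\<Sum>i\<in>I. c i)"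
  proof -
    have "{..<m} \<inter> I = I" by (auto simp: I_def)
    then show ?thesis by (simp only: sum.distrib sum.inter_restrict[symmetric] finite_lessThan) simp
  qed
  also have "\<dots> \<le> n * (H + n + 1) + 9 * n\<^sup>2" using m cost by simp
  also have "\<dots> = n * max c\<^sub>\<alpha> c\<^sub>\<beta> + n + 11 * n\<^sup>2"
    by (simp add: H_def algebra_simps power2_eq_square)
  \<comment> \<open>The leftover \<open>n\<close> is at most n^2.\<close>
  also have "\<dots> \<le> 14 * n\<^sup>2 + n * max c\<^sub>\<alpha> c\<^sub>\<beta>"
    using n by (simp add: power2_eq_square)
  finally show ?thesis using \<pi> by auto
qed

end
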